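(* Let $\nu=(\nu_1>\cdots>\nu_{2m}>0)$ be a strict partition of even length $2m\le n$. Then $$GQ_\nu(x_1,\dots,x_n)=\mathrm{Pf}\Big(\sum_{k=0}^\infty\sum_{l=0}^\infty\beta^{k+l}\binom{i+1-2m}{k}\binom{j-2m}{l}\,GQ_{(\nu_i+k,\nu_j+l)}(x_1,\dots,x_n)\Big)_{1\le i<j\le 2m}.$$
   Context: Multiplicative formal group law: $x\oplus y:=x+y+\beta xy$, $\bar x:=-x/(1+\beta x)$, $x\ominus y:=x\oplus\bar y=(x-y)/(1+\beta y)$, with $\beta$ a formal parameter. $x_1,\dots,x_n$ are indeterminates. $K$-theoretic $Q$-functions: for a strict partition $\nu$ of length $r\le n$, $GQ_\nu(x_1,\dots,x_n):=\sum_{\bar w\in S_n/(S_1)^r\times S_{n-r}}w\cdot\big[\prod_{i=1}^r(x_i\oplus x_i)x_i^{\nu_i-1}\prod_{i=1}^r\prod_{j=i+1}^n\frac{x_i\oplus x_j}{x_i\ominus x_j}\big]$ ($S_n$ permuting the $x$'s, sum over coset representatives). For arbitrary positive integers $a,b$ define $GQ_{(a,b)}(x_1,\dots,x_n):=[u_1^{-a}u_2^{-b}]\Big(G(u_1)G(u_2)\frac{u_2\ominus u_1}{u_2\oplus u_1}\Big)$, where $G(u):=\frac{1}{1+\beta u}\prod_{j=1}^n\frac{u\oplus x_j}{u\ominus x_j}$; this agrees with the previous definition when $a>b$. Expansion convention: expand in powers of the $x_j$ (denominators $u\ominus x_j$ in powers of $x_j$), and $1/(u_2\oplus u_1)$ in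 powers of $u_1$ with coefficients Laurent in $u_2$; $[m](\cdot)$ is the coefficient of the monomial $m$. $\binom{N}{k}=N(N-1)\cdots(N-k+1)/k!$ for any integer $N$ (generalized binomial coefficient). $\mathrm{Pf}(a_{ij})_{1\le i<j\le 2m}$ is the Pfaffian of the skew-symmetric $2m\times2m$ matrix with upper entries $a_{ij}$. *)

theory Defs
  imports "HOL-Library.Poly_Mapping"
          "HOL-Computational_Algebra.Polynomial"
          "HOL-Computational_Algebra.Fraction_Field"
          "HOL-Computational_Algebra.Formal_Power_Series"
          "HOL-Computational_Algebra.Formal_Laurent_Series"
          "HOL-Combinatorics.Permutations"
begin

type_synonym mpoly = "(nat \<Rightarrow>\<^sub>0 nat) \<Rightarrow>\<^sub>0 int poly"
type_synonym coef = "mpoly fract"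

definition beta :: coef where
  "beta = Fraction_Field.Fract (Poly_Mapping.single 0 [:0, 1:]) 1"

definition Xvar :: "nat \<Rightarrow> coef" where
  "Xvar i = Fraction_Field.Fract (Poly_Mapping.single (Poly_Mapping.single i 1) 1) 1"

text \<open>Power series in the x's are encoded by the homogeneous grading:
  the variable x_i is represented by X_i * t in coef fps (t = fps_X).
  This is an injective, degree-preserving ring embedding of
  Z[beta][[x_0,...,x_{n-1}]], so x-adic convergence is t-adic convergence.\<close>

definition xvar :: "nat \<Rightarrow> coef fps" where
  "xvar i = fps_const (Xvar i) * fps_X"

definition fgl_plus :: "'a::comm_ring_1 \<Rightarrow> 'a \<Rightarrow> 'a \<Rightarrow> 'a" where
  "fgl_plus b x y = x + y + b * x * y"

definition fgl_minus :: "'a::{comm_ring_1,inverse} \<Rightarrow> 'a \<Rightarrow> 'a \<Rightarrow> 'a" where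
  "fgl_minus b x y = (x - y) / (1 + b * y)"

definition oplus :: "coef fps \<Rightarrow> coef fps \<Rightarrow> coef fps" where
  "oplus = fgl_plus (fps_const beta)"

definition ominus :: "coef fps \<Rightarrow> coef fps \<Rightarrow> coef fps" where
  "ominus = fgl_minus (fps_const beta)"

text \<open>Indices are 0-based: nu ! i is nu_{i+1}, variables are x_0..x_{n-1}.
  w acts by w.f(x_0,...,x_{n-1}) = f(x_{w 0},...,x_{w (n-1)}); as coset
  representatives of S_n/(S_1)^r x S_{n-r} we take the permutations
  increasing on the positions r..n-1.\<close>

definition GQ_summand :: "nat \<Rightarrow> nat list \<Rightarrow> (nat \<Rightarrow> coef fps) \<Rightarrow> coef fps" where
  "GQ_summand n nu y =
     (\<Prod>i<length nu. oplus (y i) (y i) * (y i) ^ (nu ! i - 1)) *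
     (\<Prod>i<length nu. \<Prod>j\<in>{i+1..<n}. oplus (y i) (y j) / ominus (y i) (y j))"

definition coset_reps :: "nat \<Rightarrow> nat \<Rightarrow> (nat \<Rightarrow> nat) set" where
  "coset_reps n r = {w. w permutes {0..<n} \<and>
      (\<forall>i j. r \<le> i \<and> i < j \<and> j < n \<longrightarrow> w i < w j)}"

definition GQ :: "nat \<Rightarrow> nat list \<Rightarrow> coef fps" where
  "GQ n nu = (\<Sum>w\<in>coset_reps n (length nu). GQ_summand n nu (\<lambda>i. xvar (w i)))"

text \<open>Coefficients of the t-series live in the iterated Laurent series field
  F2 = coef((u_2))((u_1)) (outer variable u_1, inner u_2): every rational
  function in u_1,u_2 below is thus expanded in powers of u_1 with coefficients
  Laurent in u_2, and 1/(1+beta u) in powers of u; the denominators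
  u - x_j are expanded in powers of t, i.e. of the x_j.\<close>

type_synonym F2 = "coef fls fls"

definition cF2 :: "coef \<Rightarrow> F2" where
  "cF2 c = fls_const (fls_const c)"

definition u1 :: F2 where "u1 = fls_X"
definition u2 :: F2 where "u2 = fls_const fls_X"

definition xF2 :: "nat \<Rightarrow> F2 fps" where
  "xF2 j = fps_const (cF2 (Xvar j)) * fps_X"

definition GF :: "nat \<Rightarrow> F2 \<Rightarrow> F2 fps" where
  "GF n u = fps_const (inverse (1 + cF2 beta * u)) *
     (\<Prod>j<n. fgl_plus (fps_const (cF2 beta)) (fps_const u) (xF2 j)
           / fgl_minus (fps_const (cF2 beta)) (fps_const u) (xF2 j))"

definition Hfac :: F2 where
  "Hfac = fgl_minus (cF2 beta) u2 u1 / fgl_plus (cF2 beta) u2 u1"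

definition GQ2 :: "nat \<Rightarrow> nat \<Rightarrow> nat \<Rightarrow> coef fps" where
  "GQ2 n a b = Abs_fps (\<lambda>d. fls_nth (fls_nth (fps_nth (GF n u1 * GF n u2 * fps_const Hfac) d) (- int a)) (- int b))"

text \<open>binom N k = N(N-1)...(N-k+1)/k! (the division is exact).\<close>

definition binom_int :: "int \<Rightarrow> nat \<Rightarrow> int" where
  "binom_int N k = (\<Prod>i<k. N - int i) div fact k"

definition pfaffian :: "nat \<Rightarrow> (nat \<Rightarrow> nat \<Rightarrow> 'a::comm_ring_1) \<Rightarrow> 'a" where
  "pfaffian m a = (\<Sum>s\<in>{s. s permutes {1..2*m} \<and>
        (\<forall>k\<in>{1..m}. s (2*k-1) < s (2*k)) \<and>
        (\<forall>k\<in>{1..<m}. s (2*k-1) < s (2*k+1))}.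
      of_int (sign s) * (\<Prod>k\<in>{1..m}. a (s (2*k-1)) (s (2*k))))"

end

theory Submission
  imports Defs
begin

text \<open>Write \<open>h p\<close> for the residue at \<open>u = x p\<close> of the generating function \<open>G\<close>. Dividing the factors
  of \<open>G\<close> belonging to pairs of chosen variables out of the symmetrization formula shows that
  \<open>GQ n nu\<close> is the sum, over all maps \<open>g\<close> from positions to variables, of the product of the
  \<open>h (g i) * x (g i) ^ (nu i - 1)\<close> and of the ratios of formal difference and formal sum of
  \<open>x (g j)\<close> and \<open>x (g i)\<close>; maps that are not injective contribute \<open>0\<close>. For each \<open>g\<close>, Schur's Pfaffian
  identity turns the product of the ratios into a Pfaffian, where the powers of \<open>1 + b x\<close> convert
  formal differences into ordinary ones. A Pfaffian is linear in each index, so the sum over \<open>g\<close> moves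
  into the entries, and it remains to recognise an entry: expanding the powers of \<open>1 + b x\<close> into
  binomial series reduces this to the case \<open>GQ2 n a b\<close>, which follows from the partial fraction
  expansion of \<open>G\<close>, taking the coefficient in \<open>u1\<close> first and that in \<open>u2\<close> afterwards.\<close>

section \<open>Pfaffians by expansion along the first row\<close>

text \<open>The quotient of a formal difference by a formal sum need not be a power series, so the
  computations take place in Laurent series, a field into which \<open>fps_to_fls\<close> embeds
  power series injectively; there Schur's identity applies to one fixed map \<open>g\<close> at a
  time. The exponents in the statement come from the asymmetry of the formal difference. The formal
  difference of y and x is (y - x) / (1 + b x), so in the product over pairs the index i, being the
  smaller member of 2m - i pairs, collects (1 + b x_i)^(i - 2m). Distributing these factors over
  rows and columns of Schur's Pfaffian attaches (1 + b x_i)^(i - 2m) (1 + b x_j)^(j - 2m) to the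
  entry (i, j), and rewriting its numerator as a formal difference costs one more factor 1 + b x_i:
  hence i + 1 - 2m against j - 2m. For i < j <= 2m both are nonpositive, so only binomial series of
  inverse powers occur. Admitting all maps \<open>g\<close>, not only injective ones, makes the
  range of summation a product, as multilinearity of the Pfaffian requires.\<close>

definition matchings :: "nat \<Rightarrow> (nat \<Rightarrow> nat) set" where
  "matchings m = {s. s permutes {1..2*m} \<and>
        (\<forall>k\<in>{1..m}. s (2*k-1) < s (2*k)) \<and>
        (\<forall>k\<in>{1..<m}. s (2*k-1) < s (2*k+1))}"

lemma pfaffian_matchings:
  "pfaffian m a = (\<Sum>s\<in>matchings m. of_int (sign s) * (\<Prod>k\<in>{1..m}. a (s (2*k-1)) (s (2*k))))"
  by (simp add: pfaffian_def matchings_def)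

lemma matchings_permutes: "s \<in> matchings m \<Longrightarrow> s permutes {1..2*m}"
  by (simp add: matchings_def)

definition skip :: "nat \<Rightarrow> nat \<Rightarrow> nat" where
  "skip j p = (if p + 1 < j then p + 1 else p + 2)"

definition cyc :: "nat \<Rightarrow> nat \<Rightarrow> nat" where
  "cyc j x = (if x = 2 then j else if 3 \<le> x \<and> x \<le> j then x - 1 else x)"

abbreviation shift2 :: "nat \<Rightarrow> (nat \<Rightarrow> nat) \<Rightarrow> nat \<Rightarrow> nat" where
  "shift2 m s \<equiv> map_permutation {1..2*m} (\<lambda>p. p + 2) s"

lemma skip_less_iff: "skip j p < skip j q \<longleftrightarrow> p < q"
  by (auto simp: skip_def)

lemma cyc_add2: "1 \<le> p \<Longrightarrow> cyc j (p + 2) = skip j p"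
  by (auto simp: cyc_def skip_def)

lemma cyc_2: "cyc 2 = id"
  by (auto simp: cyc_def fun_eq_iff)

lemma cyc_Suc: "2 \<le> j \<Longrightarrow> cyc (Suc j) = transpose j (Suc j) \<circ> cyc j"
  by (auto simp: cyc_def fun_eq_iff transpose_def)

lemma cyc_permutes_sign: "2 \<le> j \<Longrightarrow> cyc j permutes {2..j} \<and> sign (cyc j) = (-1) ^ j"
proof (induction j rule: nat_induct_at_least)
  case base
  show ?case by (simp only: cyc_2 permutes_id sign_id) simp
next
  case (Suc j)
  have p: "cyc j permutes {2..Suc j}"
    by (rule permutes_subset[of _ "{2..j}"]) (use Suc in auto)
  have t: "transpose j (Suc j) permutes {2..Suc j}"
    by (rule permutes_swap_id) (use Suc in auto)
  have "permutation (cyc j)" "permutation (transpose j (Suc j))"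
    using p t permutation_permutes by blast+
  then show ?case
    using permutes_compose[OF p t] Suc unfolding cyc_Suc[OF Suc.hyps]
    by (simp only: sign_compose sign_swap_id) simp
qed

lemma bij_betw_shift2: "bij_betw (\<lambda>p. p + 2) {1..2*m} {3..2*Suc m}"
  by (rule bij_betwI[where g = "\<lambda>p. p - 2"]) auto

lemma shift2_permutes: "s permutes {1..2*m} \<Longrightarrow> shift2 m s permutes {3..2*Suc m}"
  by (rule map_permutation_permutes[OF bij_betw_shift2])

lemma shift2_apply: "p \<in> {1..2*m} \<Longrightarrow> shift2 m s (p + 2) = s p + 2"
  by (rule map_permutation_apply) (auto simp: inj_on_def)

text \<open>A matching of \<open>2 m + 2\<close> points consists of the partner \<open>j\<close> of \<open>1\<close> and a matching of the
  remaining points, which \<open>skip j\<close> enumerates increasingly; as a permutation this is the cycle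
  \<open>cyc j\<close>, of sign \<open>(-1) ^ j\<close>, after a shifted copy of the smaller one.\<close>

definition extend_matching :: "nat \<Rightarrow> nat \<times> (nat \<Rightarrow> nat) \<Rightarrow> nat \<Rightarrow> nat" where
  "extend_matching m = (\<lambda>(j, s). cyc j \<circ> shift2 m s)"

lemma extend_matching_low:
  assumes "s permutes {1..2*m}" "2 \<le> j"
  shows "extend_matching m (j, s) (Suc 0) = 1" "extend_matching m (j, s) 2 = j"
  using permutes_not_in[OF shift2_permutes[OF assms(1)]] assms(2)
  by (simp_all add: extend_matching_def cyc_def)

lemma extend_matching_high:
  assumes "s permutes {1..2*m}" "p \<in> {1..2*m}"
  shows "extend_matching m (j, s) (p + 2) = skip j (s p)"
proof -
  have "1 \<le> s p" using permutes_in_image[OF assms(1)] assms(2) by auto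
  then show ?thesis unfolding extend_matching_def prod.case o_apply shift2_apply[OF assms(2)]
    by (rule cyc_add2)
qed

lemma ball_1_Suc: "(\<forall>k\<in>{1..Suc m}. P k) \<longleftrightarrow> P 1 \<and> (\<forall>k\<in>{1..m}. P (Suc k))"
proof -
  have "{1..Suc m} = insert 1 (Suc ` {1..m})"
    by auto
  then show ?thesis by (simp only: ball_simps)
qed

text \<open>\<open>skip j\<close> is strictly monotone, so the order conditions on \<open>s\<close>
  and on its extension correspond; those involving the new pair of 1 and j hold automatically,
  because \<open>skip j\<close> exceeds 1 on positive arguments.\<close>

lemma extend_matching_mem_iff:
  assumes s: "s permutes {1..2*m}" and j: "j \<in> {2..2*Suc m}"
  shows "extend_matching m (j, s) \<in> matchings (Suc m) \<longleftrightarrow> s \<in> matchings m"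
proof -
  let ?e = "extend_matching m (j, s)"
  have e: "?e permutes {1..2*Suc m}"
    unfolding extend_matching_def prod.case
    by (rule permutes_compose[OF permutes_subset[OF shift2_permutes[OF s]]
          permutes_subset[of _ "{2..j}"]]) (use j cyc_permutes_sign in auto)
  have h1: "?e (Suc (2 * k)) = skip j (s (2*k-1))" if "k \<in> {1..m}" for k
  proof -
    have "2*k-1 \<in> {1..2*m}" "Suc (2 * k) = 2*k-1+2" using that by auto
    then show ?thesis by (simp only: extend_matching_high[OF s])
  qed
  have h2: "?e (Suc (Suc (2 * k))) = skip j (s (2*k))" if "k \<in> {1..m}" for k
    using extend_matching_high[OF s, of "2*k" j] that by (simp add: numeral_2_eq_2)
  have h3: "?e (Suc (Suc (Suc (2 * k)))) = skip j (s (2*k+1))" if "k \<in> {1..<m}" for k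
    using extend_matching_high[OF s, of "2*k+1" j] that by (simp add: numeral_2_eq_2)
  have low: "?e (Suc 0) = 1" "?e (Suc (Suc 0)) = j" "?e 2 = j"
    using extend_matching_low[OF s] j by (auto simp: numeral_2_eq_2)
  have A: "(\<forall>k\<in>{1..Suc m}. ?e (2*k-1) < ?e (2*k)) \<longleftrightarrow> (\<forall>k\<in>{1..m}. s (2*k-1) < s (2*k))"
    unfolding ball_1_Suc using j by (auto simp: low h1 h2 skip_less_iff numeral_2_eq_2[symmetric] simp del: One_nat_def)
  have B: "(\<forall>k\<in>{1..<Suc m}. ?e (2*k-1) < ?e (2*k+1)) \<longleftrightarrow> (\<forall>k\<in>{1..<m}. s (2*k-1) < s (2*k+1))"
  proof (cases m)
    case 0 then show ?thesis by simp
  next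
    case (Suc m')
    have i: "{1..<Suc m} = {1..Suc m'}" "{1..<m} = {1..m'}" using Suc by auto
    have "1 < skip j (s 1)" using permutes_in_image[OF s, of 1] Suc by (auto simp: skip_def)
    then show ?thesis unfolding i ball_1_Suc
      using h1 h3 Suc low h1[of 1] by (auto simp: skip_less_iff)
  qed
  show ?thesis using A B e s by (simp add: matchings_def)
qed

text \<open>The values at odd positions increase and each is smaller than its right neighbour, so
  the value at position 1 is the minimum of the whole range.\<close>

lemma matchings_fix_1:
  assumes "s \<in> matchings (Suc m)"
  shows "s 1 = 1"
proof -
  have s: "s permutes {1..2 * Suc m}" using assms by (rule matchings_permutes)
  have odd: "s 1 \<le> s (2*k-1)" if "k \<in> {1..Suc m}" for k
  proof -
    have "1 \<le> k" using that by simp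
    then show ?thesis using that
    proof (induction k rule: nat_induct_at_least)
      case (Suc k)
      then have "s (2*k-1) < s (2*k+1)" using assms by (auto simp: matchings_def)
      with Suc show ?case by auto
    qed simp
  qed
  have le: "s 1 \<le> s p" if "p \<in> {1..2 * Suc m}" for p
  proof (cases "even p")
    case True
    then obtain k where k: "p = 2 * k" by auto
    then have "s (2*k-1) < s p" using assms that by (auto simp: matchings_def)
    with odd[of k] k that show ?thesis by auto
  next
    case False
    then obtain k where k: "p = 2 * k + 1" using oddE by blast
    then show ?thesis using odd[of "Suc k"] that by auto
  qed
  have "inv s 1 \<in> {1..2 * Suc m}" using permutes_in_image[OF permutes_inv[OF s], of 1] by auto
  then have "s 1 \<le> 1" using le permutes_inverses(1)[OF s] by metis
  moreover have "s 1 \<in> {1..2 * Suc m}" using permutes_in_image[OF s, of 1] by auto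
  ultimately show ?thesis by auto
qed

text \<open>Undoing \<open>cyc j\<close>, with j the partner of 1, leaves a permutation fixing 1 and
  2, that is, a shifted copy of a permutation of \<open>2 * m\<close> points.\<close>

lemma extend_matching_surj:
  assumes "s \<in> matchings (Suc m)"
  shows "s \<in> extend_matching m ` ({2..2*Suc m} \<times> matchings m)"
proof -
  have s: "s permutes {1..2 * Suc m}" using assms by (rule matchings_permutes)
  define j where "j = s 2"
  have "s 2 \<in> {1..2*Suc m}" using permutes_in_image[OF s, of 2] by auto
  moreover have "s 2 \<noteq> 1" using matchings_fix_1[OF assms] permutes_inj[OF s] by (metis inj_eq numeral_eq_one_iff semiring_norm(85))
  ultimately have j: "j \<in> {2..2*Suc m}" by (auto simp: j_def)
  have cj: "cyc j permutes {1..2*Suc m}"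
    using permutes_subset[of "cyc j" "{2..j}"] cyc_permutes_sign[of j] j by auto
  define t where "t = inv (cyc j) \<circ> s"
  have t: "t permutes {1..2*Suc m}" unfolding t_def
    by (rule permutes_compose[OF s permutes_inv[OF cj]])
  have "cyc j 1 = 1" "cyc j 2 = j" by (auto simp: cyc_def)
  then have "t 1 = 1" "t 2 = 2"
    using matchings_fix_1[OF assms] permutes_inv_eq[OF cj] by (auto simp: t_def j_def)
  then have "t permutes {3..2*Suc m}"
    by (intro permutes_superset[OF t]) (metis atLeastAtMost_iff DiffE Suc_leI le_neq_implies_less One_nat_def numeral_2_eq_2 numeral_3_eq_3)
  note t = this
  define s' where "s' = map_permutation {3..2*Suc m} (\<lambda>x. x - 2) t"
  have b: "bij_betw (\<lambda>x::nat. x - 2) {3..2*Suc m} {1..2*m}"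
    by (rule bij_betwI[where g = "\<lambda>p. p + 2"]) auto
  have s': "s' permutes {1..2*m}" unfolding s'_def by (rule map_permutation_permutes[OF b t])
  have "shift2 m s' = t" unfolding s'_def
    by (rule map_permutation_compose_inv[OF b t]) auto
  then have e: "s = extend_matching m (j, s')"
    using permutes_inverses(1)[OF cj] by (simp add: extend_matching_def t_def fun_eq_iff)
  then have "s' \<in> matchings m" using assms extend_matching_mem_iff[OF s' j] by simp
  then show ?thesis using e j by blast
qed

lemma extend_matching_bij:
  "bij_betw (extend_matching m) ({2..2*Suc m} \<times> matchings m) (matchings (Suc m))"
  unfolding bij_betw_def
proof
  show "inj_on (extend_matching m) ({2..2*Suc m} \<times> matchings m)"
  proof (rule inj_onI; clarify)
    fix j s j' s'
    assume a: "j \<in> {2..2*Suc m}" "j' \<in> {2..2*Suc m}" "s \<in> matchings m" "s' \<in> matchings m"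
      and eq: "extend_matching m (j, s) = extend_matching m (j', s')"
    note p = a(3,4)[THEN matchings_permutes]
    have j: "j = j'" using eq extend_matching_low(2)[OF p(1), of j] extend_matching_low(2)[OF p(2), of j'] a by auto
    have "s x = s' x" for x
    proof (cases "x \<in> {1..2*m}")
      case True
      have "skip j (s x) = skip j (s' x)"
        using eq extend_matching_high[OF p(1) True, of j] extend_matching_high[OF p(2) True, of j] j by simp
      then show ?thesis using skip_less_iff by (metis nat_neq_iff)
    next
      case False
      then show ?thesis using p by (simp add: permutes_not_in)
    qed
    with j show "j = j' \<and> s = s'" by auto
  qed
  show "extend_matching m ` ({2..2*Suc m} \<times> matchings m) = matchings (Suc m)"
    using extend_matching_surj extend_matching_mem_iff[OF matchings_permutes] by auto
qed

lemma sign_extend_matching: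
  assumes "s permutes {1..2*m}" "2 \<le> j"
  shows "sign (extend_matching m (j, s)) = (-1) ^ j * sign s"
proof -
  have "permutation (cyc j)" "permutation (shift2 m s)"
    using cyc_permutes_sign[OF assms(2)] shift2_permutes[OF assms(1)] permutation_permutes by blast+
  moreover have "sign (shift2 m s) = sign s"
    by (rule sign_map_permutation) (use assms in \<open>auto simp: inj_on_def\<close>)
  ultimately show ?thesis
    using cyc_permutes_sign[OF assms(2)] by (simp add: extend_matching_def sign_compose)
qed

text \<open>Here \<open>skip j\<close> deletes rows and columns 1 and j. This recursion drives the
  induction in Schur's identity.\<close>

lemma pfaffian_Suc:
  "pfaffian (Suc m) a = (\<Sum>j\<in>{2..2*Suc m}. (-1) ^ j * a 1 j * pfaffian m (\<lambda>p q. a (skip j p) (skip j q)))"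
proof -
  have *: "of_int (sign (extend_matching m (j, s))) *
      (\<Prod>k\<in>{1..Suc m}. a (extend_matching m (j, s) (2*k-1)) (extend_matching m (j, s) (2*k)))
     = (-1) ^ j * a 1 j * (of_int (sign s) * (\<Prod>k\<in>{1..m}. a (skip j (s (2*k-1))) (skip j (s (2*k)))))"
    if j: "j \<in> {2..2*Suc m}" and s: "s \<in> matchings m" for j s
  proof -
    note p = matchings_permutes[OF s]
    let ?e = "extend_matching m (j, s)"
    have h: "?e (Suc (2 * k)) = skip j (s (2*k-1))" "?e (Suc (Suc (2 * k))) = skip j (s (2*k))"
      if "k \<in> {1..m}" for k
    proof -
      have "2*k-1 \<in> {1..2*m}" "2*k \<in> {1..2*m}" "Suc (2 * k) = 2*k-1+2" "Suc (Suc (2 * k)) = 2*k+2"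
        using that by auto
      then show "?e (Suc (2 * k)) = skip j (s (2*k-1))" "?e (Suc (Suc (2 * k))) = skip j (s (2*k))"
        by (simp_all only: extend_matching_high[OF p])
    qed
    have "(\<Prod>k\<in>{1..Suc m}. a (?e (2*k-1)) (?e (2*k))) = a 1 j * (\<Prod>k\<in>{1..m}. a (?e (Suc (2*k))) (?e (Suc (Suc (2*k)))))"
      using extend_matching_low[OF p, of j] j
      by (subst prod.atLeast_Suc_atMost) (simp_all add: prod.shift_bounds_cl_Suc_ivl del: prod.cl_ivl_Suc)
    also have "(\<Prod>k\<in>{1..m}. a (?e (Suc (2*k))) (?e (Suc (Suc (2*k)))))
       = (\<Prod>k\<in>{1..m}. a (skip j (s (2*k-1))) (skip j (s (2*k))))"
      by (rule prod.cong) (auto simp: h)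
    finally show ?thesis using sign_extend_matching[OF p, of j] j by (simp add: mult_ac)
  qed
  show ?thesis
    unfolding pfaffian_matchings sum_distrib_left sum.cartesian_product
    by (subst sum.reindex_bij_betw[OF extend_matching_bij, symmetric], rule sum.cong[OF refl])
       (use * in auto)
qed

lemma pfaffian_0: "pfaffian 0 a = 1"
proof -
  have "matchings 0 = {id}" by (auto simp: matchings_def)
  then show ?thesis by (simp add: pfaffian_matchings)
qed

section \<open>Schur's Pfaffian identity\<close>

text \<open>Lagrange interpolation at the nodes \<open>A\<close> reproduces \<open>g\<close>, and
  the sum is the coefficient of degree \<open>card A - 1\<close> of the interpolant, which vanishes
  by the degree bound. In other words, \<open>g\<close> divided by the product of all x - a has no
  residue at infinity.\<close>

lemma sum_residues_eq_0:
  fixes g :: "'a::field poly"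
  assumes "finite A" "degree g + 2 \<le> card A"
  shows "(\<Sum>a\<in>A. poly g a / (\<Prod>b\<in>A-{a}. a - b)) = 0"
proof -
  define c where "c a = poly g a / (\<Prod>b\<in>A-{a}. a - b)" for a
  define l where "l a = (\<Prod>b\<in>A-{a}. [:-b, 1:])" for a
  define L where "L = (\<Sum>a\<in>A. smult (c a) (l a))"
  have deg_l: "degree (l a) = card A - 1" and lead_l: "coeff (l a) (card A - 1) = 1" if "a \<in> A" for a
  proof -
    show d: "degree (l a) = card A - 1"
      unfolding l_def using that assms(1) by (subst degree_prod_eq_sum_degree) auto
    have "lead_coeff (l a) = 1" unfolding l_def by (subst lead_coeff_prod) simp
    then show "coeff (l a) (card A - 1) = 1" by (simp add: d)
  qed
  have pl: "poly (l a) x = (\<Prod>b\<in>A-{a}. x - b)" for a x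
    by (simp add: l_def poly_prod)
  have "poly L x = poly g x" if x: "x \<in> A" for x
  proof -
    have "poly L x = (\<Sum>a\<in>A. c a * (\<Prod>b\<in>A-{a}. x - b))" by (simp add: L_def poly_sum pl)
    also have "\<dots> = c x * (\<Prod>b\<in>A-{x}. x - b)"
      using assms(1) x by (subst sum.remove[OF _ x]) (auto intro!: sum.neutral prod_zero)
    also have "\<dots> = poly g x" using assms(1) by (simp add: c_def)
    finally show ?thesis .
  qed
  then have roots: "A \<subseteq> {x. poly (L - g) x = 0}" by auto
  have "degree L \<le> card A - 1" unfolding L_def
    by (intro degree_sum_le assms(1)) (metis deg_l degree_smult_le)
  then have "degree (L - g) < card A" using assms(2) degree_diff_le_max[of L g] by linarith
  then have "L - g = 0"
    using roots card_mono[OF poly_roots_finite[of "L - g"] roots] card_poly_roots_bound[of "L - g"] by linarith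
  then have "coeff L (card A - 1) = coeff g (card A - 1)" by simp
  also have "\<dots> = 0" using assms(2) by (intro coeff_eq_0) linarith
  also have "coeff L (card A - 1) = (\<Sum>a\<in>A. c a)"
    unfolding L_def coeff_sum using lead_l by (intro sum.cong) auto
  finally show ?thesis by (simp add: c_def)
qed

lemma prod_minus: "(\<Prod>i\<in>A. - f i :: 'a::comm_ring_1) = (-1) ^ card A * (\<Prod>i\<in>A. f i)"
  using prod.distrib[of "\<lambda>_. -1" f A] by simp

text \<open>The residues at the nodes \<open>0\<close> and \<open>-2/b\<close> cancel precisely because the number of the \<open>u k\<close> is odd;
  the remaining node is the formal inverse of \<open>z\<close>.\<close>

lemma schur_residue_identity:
  fixes b z :: "'a::field" and u :: "nat \<Rightarrow> 'a"
  assumes I: "finite I" "odd (card I)" and inj: "inj_on u I"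
    and b: "b \<noteq> 0" and two: "(2::'a) \<noteq> 0"
    and z: "1 + b * z \<noteq> 0" "fgl_plus b z z \<noteq> 0"
    and zu: "\<And>k. k \<in> I \<Longrightarrow> fgl_plus b z (u k) \<noteq> 0"
    and uu: "\<And>j k. j \<in> I \<Longrightarrow> k \<in> I \<Longrightarrow> fgl_plus b (u j) (u k) \<noteq> 0"
  shows "(\<Sum>j\<in>I. (u j - z) / fgl_plus b z (u j) * (\<Prod>k\<in>I-{j}. fgl_plus b (u j) (u k) / (u j - u k)))
    = (\<Prod>k\<in>I. (u k - z) / fgl_plus b z (u k))"
proof -
  define zb where "zb = - z / (1 + b * z)"
  define w where "w = - 2 / b"
  have bw: "b * w = -2" using b by (simp add: w_def)
  have bzb: "(1 + b * z) * zb = - z" using z by (simp add: zb_def)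
  \<comment> \<open>By \<open>dbl\<close> and \<open>zz\<close>, \<open>B\<close> is the factor
    between x (x - w) (x - zb) and the product of \<open>fgl_plus b x x\<close> and
    \<open>fgl_plus b z x\<close>.\<close>
  define B where "B = b * (1 + b * z)"
  have B0: "B \<noteq> 0" using b z by (simp add: B_def)
  have dbl: "fgl_plus b x x = b * (x * (x - w))" for x
  proof -
    have "b * (x * (x - w)) = b * x * x - x * (b * w)" by (simp add: algebra_simps)
    then show ?thesis unfolding bw by (simp add: fgl_plus_def)
  qed
  have zz: "(1 + b * z) * (x - zb) = fgl_plus b z x" for x
    using bzb by (simp add: fgl_plus_def algebra_simps)
  have u_nz: "u k \<noteq> 0" "u k \<noteq> w" "u k \<noteq> zb" if "k \<in> I" for k
    using uu[OF that that] zu[OF that] zz[of "u k"] by (auto simp: dbl)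
  have w0: "w \<noteq> 0" using b two by (simp add: w_def)
  have z_nz: "z \<noteq> 0" "z \<noteq> w" using z by (auto simp: dbl)
  have zb0: "zb \<noteq> 0" using bzb z_nz by auto
  have zbw: "(1 + b * z) * (zb - w) = z - w"
  proof -
    have "(1 + b * z) * (zb - w) = (1 + b * z) * zb - w - z * (b * w)" by (simp add: algebra_simps)
    then show ?thesis unfolding bzb bw by simp
  qed
  have zbw0: "zb \<noteq> w" using zbw z_nz by auto
  let ?U = "u ` I"
  define A where "A = insert 0 (insert w (insert zb ?U))"
  have fin: "finite A" using I by (simp add: A_def)
  have notin: "0 \<notin> ?U" "w \<notin> ?U" "zb \<notin> ?U" using u_nz by auto
  have card: "card A = card I + 3"
    using notin w0 zb0 zbw0 I inj by (auto simp: A_def card_image)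
  \<comment> \<open>Divided by the product of x - a over the nodes, \<open>g\<close> is
    \<open>B\<close> times (x - z) / (\<open>fgl_plus b x x\<close> \<open>fgl_plus b z x\<close>)
    times the product of the \<open>fgl_plus b x (u k) / (x - u k)\<close>. Its residues at the
    \<open>u j\<close> are \<open>B\<close> times the required summands.\<close>
  define g where "g = (\<Prod>k\<in>I. [:u k, 1 + b * u k:]) * [:- z, 1:]"
  have pg: "poly g x = (\<Prod>k\<in>I. fgl_plus b x (u k)) * (x - z)" for x
    by (simp add: g_def poly_prod fgl_plus_def algebra_simps)
  have "degree g \<le> degree (\<Prod>k\<in>I. [:u k, 1 + b * u k:]) + 1"
    unfolding g_def using degree_mult_le[of "\<Prod>k\<in>I. [:u k, 1 + b * u k:]" "[:- z, 1:]"] by simp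
  also have "degree (\<Prod>k\<in>I. [:u k, 1 + b * u k:]) \<le> (\<Sum>k\<in>I. degree [:u k, 1 + b * u k:])"
    by (rule order.trans[OF degree_prod_sum_le[OF I(1)]]) (simp add: o_def)
  also have "\<dots> \<le> (\<Sum>k\<in>I. 1)" by (intro sum_mono) simp
  finally have deg: "degree g + 2 \<le> card A" using card by simp
  define R where "R a = poly g a / (\<Prod>c\<in>A-{a}. a - c)" for a
  have pU: "(\<Prod>c\<in>?U. f c) = (\<Prod>k\<in>I. f (u k))" for f :: "'a \<Rightarrow> 'a"
    using inj by (simp add: prod.reindex)
  have 0: "R 0 + R w + R zb + (\<Sum>j\<in>I. R (u j)) = 0"
  proof -
    have "(\<Sum>a\<in>A. R a) = R 0 + R w + R zb + (\<Sum>j\<in>I. R (u j))"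
      using notin w0 zb0 zbw0 I inj by (simp add: A_def sum.reindex add.assoc)
    then show ?thesis using sum_residues_eq_0[OF fin deg] by (simp add: R_def)
  qed
  have neg: "(\<Prod>k\<in>I. - f k) = - (\<Prod>k\<in>I. f k)" for f :: "nat \<Rightarrow> 'a"
    using I by (simp add: prod_minus)
  have R0: "R 0 = B / 2"
  proof -
    have "A - {0} = insert w (insert zb ?U)" using notin w0 zb0 by (auto simp: A_def)
    then have "R 0 = (\<Prod>k\<in>I. u k) * (- z) / (- w * (- zb * - (\<Prod>k\<in>I. u k)))"
      using notin w0 zb0 zbw0 I unfolding R_def pg
      by (simp add: pU fgl_plus_def neg)
    also have "\<dots> = z / (w * zb)"
      using u_nz I by (simp add: field_simps)
    also have "\<dots> = B / 2"
    proof -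
      have "B * (w * zb) = (b * w) * ((1 + b * z) * zb)" by (simp add: B_def algebra_simps)
      then have "B * (w * zb) = 2 * z" unfolding bw bzb by simp
      then show ?thesis using w0 zb0 two by (simp add: field_simps)
    qed
    finally show ?thesis .
  qed
  have Rw: "R w = - (B / 2)"
  proof -
    have e: "A - {w} = insert 0 (insert zb ?U)" using notin w0 zb0 zbw0 by (auto simp: A_def)
    \<comment> \<open>Here each quotient of \<open>fgl_plus b w (u k)\<close> by
      \<open>w - u k\<close> is 1; at the node 0 each was -1, and this is where the parity of
      \<open>card I\<close> enters.\<close>
    have f: "fgl_plus b w x = w - x" for x using bw by (simp add: fgl_plus_def)
    have p: "(\<Prod>k\<in>I. w - u k) \<noteq> 0" using u_nz I by auto
    have "R w = (\<Prod>k\<in>I. w - u k) * (w - z) / (w * ((w - zb) * (\<Prod>k\<in>I. w - u k)))"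
      using notin w0 zb0 zbw0 I unfolding R_def pg e
      by (simp add: pU f)
    also have "\<dots> = (w - z) / (w * (w - zb))"
      using p by simp
    also have "\<dots> = - (B / 2)"
    proof -
      have "B * (w * (w - zb)) = - ((b * w) * ((1 + b * z) * (zb - w)))" by (simp add: B_def algebra_simps)
      then have "(w - z) * 2 = - B * (w * (w - zb))" unfolding bw zbw by simp
      then have "w - z = - (B / 2) * (w * (w - zb))" using two by (simp add: field_simps)
      then show ?thesis using w0 zbw0 by (simp add: nonzero_divide_eq_eq)
    qed
    finally show ?thesis .
  qed
  have Rzb: "R zb = - B * (\<Prod>k\<in>I. (u k - z) / fgl_plus b z (u k))"
  proof -
    have e: "A - {zb} = insert 0 (insert w ?U)" using notin w0 zb0 zbw0 by (auto simp: A_def)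
    \<comment> \<open>Formally adding the inverse of z is formally subtracting z, so this node
      produces the right-hand side.\<close>
    have f: "fgl_plus b zb x = (x - z) / (1 + b * z)" for x
    proof -
      have "(1 + b * z) * fgl_plus b zb x = (1 + b * z) * zb * (1 + b * x) + (1 + b * z) * x"
        by (simp add: fgl_plus_def algebra_simps)
      then have "(1 + b * z) * fgl_plus b zb x = x - z" unfolding bzb by (simp add: algebra_simps)
      then show ?thesis using z(1) by (simp add: eq_divide_eq mult.commute)
    qed
    have h: "zb - x = - (fgl_plus b z x / (1 + b * z))" for x
      unfolding zz[of x, symmetric] using z(1) by simp
    have "R zb = (\<Prod>k\<in>I. (u k - z) / (1 + b * z)) * (zb - z) / (zb * ((zb - w) * (- (\<Prod>k\<in>I. fgl_plus b z (u k) / (1 + b * z)))))"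
      using notin w0 zb0 zbw0 I unfolding R_def pg e
      by (simp add: pU f h[of "u _"] neg)
    also have "\<dots> = - ((zb - z) / (zb * (zb - w))) *
        ((\<Prod>k\<in>I. (u k - z) / (1 + b * z)) / (\<Prod>k\<in>I. fgl_plus b z (u k) / (1 + b * z)))"
      by (simp add: mult_ac)
    also have "(\<Prod>k\<in>I. (u k - z) / (1 + b * z)) / (\<Prod>k\<in>I. fgl_plus b z (u k) / (1 + b * z))
        = (\<Prod>k\<in>I. (u k - z) / fgl_plus b z (u k))"
      unfolding prod_dividef[symmetric] using z(1) by simp
    also have "(zb - z) / (zb * (zb - w)) = B"
    proof -
      have "(zb - z) = B * (zb * (zb - w))"
      proof -
        have "B * (zb * (zb - w)) = b * ((1 + b * z) * zb) * zb - (1 + b * z) * zb * (b * w)"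
          by (simp add: B_def algebra_simps)
        then have "B * (zb * (zb - w)) = - (2 * z) - b * z * zb" unfolding bw bzb by (simp add: mult.commute)
        moreover have "b * z * zb = - z - zb" using bzb by (simp add: distrib_right eq_diff_eq add.commute)
        ultimately show ?thesis by simp
      qed
      then show ?thesis using zb0 zbw0 by (simp add: divide_simps)
    qed
    finally show ?thesis by simp
  qed
  have Ru: "R (u j) = B * ((u j - z) / fgl_plus b z (u j) * (\<Prod>k\<in>I-{j}. fgl_plus b (u j) (u k) / (u j - u k)))"
    if j: "j \<in> I" for j
  proof -
    have e: "A - {u j} = insert 0 (insert w (insert zb (u ` (I - {j}))))"
      using u_nz[OF j] inj j by (auto simp: A_def inj_on_def)
    have n: "0 \<notin> u ` (I - {j})" "w \<notin> u ` (I - {j})" "zb \<notin> u ` (I - {j})" using notin by auto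
    have p: "(\<Prod>c\<in>u ` (I - {j}). f c) = (\<Prod>k\<in>I-{j}. f (u k))" for f :: "'a \<Rightarrow> 'a"
      using inj by (subst prod.reindex) (auto intro: inj_on_subset)
    have q: "(\<Prod>k\<in>I. fgl_plus b (u j) (u k)) = fgl_plus b (u j) (u j) * (\<Prod>k\<in>I-{j}. fgl_plus b (u j) (u k))"
      using I j by (simp add: prod.remove)
    have "R (u j) = b * (u j * (u j - w)) * (\<Prod>k\<in>I-{j}. fgl_plus b (u j) (u k)) * (u j - z)
       / (u j * ((u j - w) * ((u j - zb) * (\<Prod>k\<in>I-{j}. u j - u k))))"
      using n w0 zb0 zbw0 I unfolding R_def pg e q dbl[symmetric]
      by (simp add: p)
    also have "\<dots> = b / (u j - zb) * (u j - z) * (\<Prod>k\<in>I-{j}. fgl_plus b (u j) (u k) / (u j - u k))"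
    proof -
      have *: "b * (x * y) * P * t / (x * (y * (v * Q))) = b / v * t * (P / Q)"
        if "x \<noteq> 0" "y \<noteq> 0" for x y P t v Q :: 'a
        using that by simp
      show ?thesis unfolding prod_dividef by (rule *) (use u_nz[OF j] in auto)
    qed
    also have "b / (u j - zb) = B / fgl_plus b z (u j)"
      unfolding B_def zz[of "u j", symmetric] using z by simp
    finally show ?thesis by simp
  qed
  have "B * (\<Sum>j\<in>I. (u j - z) / fgl_plus b z (u j) * (\<Prod>k\<in>I-{j}. fgl_plus b (u j) (u k) / (u j - u k)))
     = B * (\<Prod>k\<in>I. (u k - z) / fgl_plus b z (u k))"
    using 0 unfolding R0 Rw Rzb sum_distrib_left using sum.cong[OF refl Ru, of I "\<lambda>x. x"] by simp
  then show ?thesis using B0 by simp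
qed

lemma bij_betw_skip:
  assumes "j \<in> {2..2*Suc m}"
  shows "bij_betw (skip j) {1..2*m} ({2..2*Suc m} - {j})"
  by (rule bij_betwI[where g = "\<lambda>p. if p < j then p - 1 else p - 2"])
     (use assms in \<open>auto simp: skip_def split: if_splits\<close>)

section \<open>Products over increasing pairs of indices\<close>

definition pairs :: "nat set \<Rightarrow> (nat \<times> nat) set" where
  "pairs S = {(i, j). i \<in> S \<and> j \<in> S \<and> i < j}"

lemma mem_pairs: "(i, j) \<in> pairs S \<longleftrightarrow> i \<in> S \<and> j \<in> S \<and> i < j"
  by (simp add: pairs_def)

lemma finite_pairs: "finite S \<Longrightarrow> finite (pairs S)"
  by (rule finite_subset[of _ "S \<times> S"]) (auto simp: pairs_def)

lemma prod_pairs_reindex: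
  assumes "bij_betw f S T" "\<And>i j. f i < f j \<longleftrightarrow> i < j"
  shows "(\<Prod>(i,j)\<in>pairs S. F (f i) (f j)) = (\<Prod>(i,j)\<in>pairs T. F i j)"
proof -
  have "inj_on (map_prod f f) (S \<times> S)"
    using assms(1) by (intro map_prod_inj_on) (auto simp: bij_betw_def)
  then have "inj_on (map_prod f f) (pairs S)" by (rule inj_on_subset) (auto simp: pairs_def)
  moreover have "map_prod f f ` pairs S = pairs T"
    using assms by (fastforce simp: bij_betw_def image_iff pairs_def)
  ultimately have "bij_betw (map_prod f f) (pairs S) (pairs T)" by (simp add: bij_betw_def)
  from prod.reindex_bij_betw[OF this, of "\<lambda>(i,j). F i j"] show ?thesis
    by (simp add: case_prod_unfold)
qed

lemma prod_pairs_insert_less: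
  fixes F :: "nat \<Rightarrow> nat \<Rightarrow> 'a::comm_monoid_mult"
  assumes "finite S" "\<And>k. k \<in> S \<Longrightarrow> i < k"
  shows "(\<Prod>(i,j)\<in>pairs (insert i S). F i j) = (\<Prod>k\<in>S. F i k) * (\<Prod>(i,j)\<in>pairs S. F i j)"
proof -
  have "pairs (insert i S) = Pair i ` S \<union> pairs S" using assms(2) by (force simp: pairs_def)
  moreover have "Pair i ` S \<inter> pairs S = {}" using assms(2) by (auto simp: pairs_def)
  ultimately show ?thesis using assms(1)
    by (simp add: prod.union_disjoint finite_pairs prod.reindex inj_on_def)
qed

text \<open>Bringing j to the front reverses each pair (i, j) with i < j, at the cost of one sign
  per pair; these signs compensate the one that \<open>pfaffian_Suc\<close> attaches to column
  j.\<close>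

lemma prod_pairs_remove_antisym:
  fixes F :: "nat \<Rightarrow> nat \<Rightarrow> 'a::comm_ring_1"
  assumes S: "finite S" "j \<in> S" and anti: "\<And>i k. i \<in> S \<Longrightarrow> k \<in> S \<Longrightarrow> F i k = - F k i"
  shows "(\<Prod>(i,k)\<in>pairs S. F i k)
    = (-1) ^ card {i\<in>S. i < j} * (\<Prod>k\<in>S-{j}. F j k) * (\<Prod>(i,k)\<in>pairs (S-{j}). F i k)"
proof -
  let ?L = "{i\<in>S. i < j}" and ?G = "{i\<in>S. j < i}"
  have "pairs S = ((\<lambda>i. (i, j)) ` ?L \<union> Pair j ` ?G) \<union> pairs (S - {j})" using S(2) by (force simp: pairs_def)
  moreover have "((\<lambda>i. (i, j)) ` ?L \<union> Pair j ` ?G) \<inter> pairs (S - {j}) = {}"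
    "(\<lambda>i. (i, j)) ` ?L \<inter> Pair j ` ?G = {}" by (auto simp: pairs_def)
  ultimately have "(\<Prod>(i,k)\<in>pairs S. F i k)
    = ((\<Prod>i\<in>?L. F i j) * (\<Prod>k\<in>?G. F j k)) * (\<Prod>(i,k)\<in>pairs (S - {j}). F i k)"
    using S(1) by (simp add: prod.union_disjoint finite_pairs prod.reindex inj_on_def)
  also have "(\<Prod>i\<in>?L. F i j) = (\<Prod>i\<in>?L. - F j i)" by (intro prod.cong refl anti) (use S in auto)
  also have "\<dots> = (-1) ^ card ?L * (\<Prod>i\<in>?L. F j i)" by (rule prod_minus)
  also have "(-1) ^ card ?L * (\<Prod>i\<in>?L. F j i) * (\<Prod>k\<in>?G. F j k) = (-1) ^ card ?L * (\<Prod>k\<in>S-{j}. F j k)"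
  proof -
    have "S - {j} = ?L \<union> ?G" "?L \<inter> ?G = {}" by (auto simp: pairs_def)
    then show ?thesis using S(1) by (simp add: prod.union_disjoint mult.assoc)
  qed
  finally show ?thesis .
qed

text \<open>After expansion along the first row the induction hypothesis turns each minor into a
  product; dividing by the product over all pairs from \<open>S\<close> leaves the summands of
  \<open>schur_residue_identity\<close> with \<open>u 1\<close> in the role of z.\<close>

lemma schur_pfaffian_distinct:
  fixes b :: "'a::field" and u :: "nat \<Rightarrow> 'a"
  assumes b: "b \<noteq> 0" and two: "(2::'a) \<noteq> 0" and "inj_on u {1..2*m}"
    and "\<And>k. k \<in> {1..2*m} \<Longrightarrow> 1 + b * u k \<noteq> 0"
    and "\<And>j k. j \<in> {1..2*m} \<Longrightarrow> k \<in> {1..2*m} \<Longrightarrow> fgl_plus b (u j) (u k) \<noteq> 0"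
  shows "pfaffian m (\<lambda>i j. (u j - u i) / fgl_plus b (u i) (u j))
    = (\<Prod>(i,j)\<in>pairs {1..2*m}. (u j - u i) / fgl_plus b (u i) (u j))"
  using assms(3-)
proof (induction m arbitrary: u)
  case 0
  show ?case by (simp add: pfaffian_0 pairs_def)
next
  case (Suc m)
  let ?F = "\<lambda>i j. (u j - u i) / fgl_plus b (u i) (u j)"
  define S where "S = {2..2*Suc m}"
  have S1: "{1..2*Suc m} = insert 1 S" unfolding S_def by auto
  have S: "finite S" "card S = 2 * m + 1" "\<And>k. k \<in> S \<Longrightarrow> 1 < k" by (auto simp: S_def)
  have pl: "fgl_plus b x y = fgl_plus b y x" for x y by (simp add: fgl_plus_def algebra_simps)
  have anti: "?F i k = - ?F k i" for i k
    using pl[of "u i" "u k"] by (simp add: minus_divide_left)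
  define P where "P = (\<Prod>(i,j)\<in>pairs S. ?F i j)"
  have IH: "pfaffian m (\<lambda>p q. ?F (skip j p) (skip j q)) = (\<Prod>(i,j)\<in>pairs (S - {j}). ?F i j)" if j: "j \<in> S" for j
  proof -
    note bij = bij_betw_skip[OF j[unfolded S_def], folded S_def]
    have im: "skip j p \<in> {1..2*Suc m}" if "p \<in> {1..2*m}" for p
      using bij_betw_apply[OF bij that] S1 by auto
    have "inj_on (u \<circ> skip j) {1..2*m}"
      using bij im by (intro comp_inj_on inj_on_subset[OF Suc.prems(1)]) (auto simp: bij_betw_def S_def)
    from Suc.IH[OF this] Suc.prems im
    have "pfaffian m (\<lambda>p q. ?F (skip j p) (skip j q)) = (\<Prod>(p,q)\<in>pairs {1..2*m}. ?F (skip j p) (skip j q))"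
      by simp
    also have "\<dots> = (\<Prod>(i,j)\<in>pairs (S - {j}). ?F i j)"
      by (rule prod_pairs_reindex[OF bij skip_less_iff])
    finally show ?thesis .
  qed
  have R: "(-1) ^ j * (\<Prod>(i,j)\<in>pairs (S - {j}). ?F i j) = P * (\<Prod>k\<in>S-{j}. fgl_plus b (u j) (u k) / (u j - u k))"
    if j: "j \<in> S" for j
  proof -
    \<comment> \<open>\<open>S\<close> starts at 2, so j - 2 indices precede j, a number of the same
      parity as j.\<close>
    have jj: "{i\<in>S. i < j} = {2..<j}" using j by (auto simp: S_def)
    have "P = (-1) ^ (j - 2) * (\<Prod>k\<in>S-{j}. ?F j k) * (\<Prod>(i,j)\<in>pairs (S - {j}). ?F i j)"
      unfolding P_def using prod_pairs_remove_antisym[OF S(1) j, of ?F, OF anti] by (simp add: jj)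
    also have "(-1) ^ (j - 2) = ((-1) ^ j :: 'a)"
      using j by (auto simp: S_def minus_one_power_iff)
    finally have P: "P = (-1) ^ j * (\<Prod>k\<in>S-{j}. ?F j k) * (\<Prod>(i,j)\<in>pairs (S - {j}). ?F i j)" .
    have ne: "?F j k \<noteq> 0" if "k \<in> S - {j}" for k
    proof -
      have jk: "j \<in> {1..2*Suc m}" "k \<in> {1..2*Suc m}" unfolding S1 using j that by auto
      show ?thesis using inj_onD[OF Suc.prems(1) _ jk] Suc.prems(3)[OF jk] that by auto
    qed
    \<comment> \<open>\<open>S\<close> has \<open>2 * m + 1\<close> elements, so the signs between
      \<open>u j - u k\<close> and \<open>u k - u j\<close> cancel over
      \<open>S - {j}\<close>.\<close>
    have "even (card (S - {j}))" using S j by simp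
    then have "(\<Prod>k\<in>S-{j}. fgl_plus b (u j) (u k) / (u j - u k)) = (\<Prod>k\<in>S-{j}. - (fgl_plus b (u j) (u k) / (u j - u k)))"
      by (simp add: prod_minus)
    also have "\<dots> = (\<Prod>k\<in>S-{j}. inverse (?F j k))"
      by (intro prod.cong refl) (simp add: minus_divide_right)
    also have "\<dots> = inverse (\<Prod>k\<in>S-{j}. ?F j k)"
      by (simp only: prod_inversef[symmetric] o_def)
    finally have "(\<Prod>k\<in>S-{j}. fgl_plus b (u j) (u k) / (u j - u k)) = inverse (\<Prod>k\<in>S-{j}. ?F j k)" .
    moreover have "(\<Prod>k\<in>S-{j}. ?F j k) \<noteq> 0" using ne S(1) by (simp only: prod_zero_iff finite_Diff) blast
    ultimately show ?thesis unfolding P by simp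
  qed
  have "pfaffian (Suc m) ?F = (\<Sum>j\<in>S. ?F 1 j * ((-1) ^ j * pfaffian m (\<lambda>p q. ?F (skip j p) (skip j q))))"
    unfolding pfaffian_Suc S_def by (simp only: mult_ac)
  also have "\<dots> = (\<Sum>j\<in>S. ?F 1 j * (P * (\<Prod>k\<in>S-{j}. fgl_plus b (u j) (u k) / (u j - u k))))"
    by (intro sum.cong refl) (simp only: IH R)
  also have "\<dots> = P * (\<Sum>j\<in>S. ?F 1 j * (\<Prod>k\<in>S-{j}. fgl_plus b (u j) (u k) / (u j - u k)))"
    by (simp add: sum_distrib_left mult_ac)
  also have "(\<Sum>j\<in>S. ?F 1 j * (\<Prod>k\<in>S-{j}. fgl_plus b (u j) (u k) / (u j - u k))) = (\<Prod>k\<in>S. ?F 1 k)"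
    by (rule schur_residue_identity)
       (use Suc.prems[unfolded S1] S b two in auto)
  also have "P * (\<Prod>k\<in>S. ?F 1 k) = (\<Prod>(i,j)\<in>pairs {1..2*Suc m}. ?F i j)"
    unfolding S1 P_def by (subst prod_pairs_insert_less) (use S in auto)
  finally show ?case .
qed


section \<open>Pfaffians under ring homomorphisms, and Schur's identity for arguments that may
  coincide\<close>

locale ring_morphism =
  fixes h :: "'a::comm_ring_1 \<Rightarrow> 'b::comm_ring_1"
  assumes hom_add: "h (x + y) = h x + h y"
    and hom_mult: "h (x * y) = h x * h y"
    and hom_1: "h 1 = 1"
begin

lemma hom_0: "h 0 = 0"
  using hom_add[of 0 0] by simp

lemma hom_minus: "h (- x) = - h x"
  using hom_add[of x "- x"] by (simp add: hom_0 minus_unique)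

lemma hom_diff: "h (x - y) = h x - h y"
  using hom_add[of x "- y"] by (simp add: hom_minus)

lemma hom_sum: "h (sum f A) = (\<Sum>x\<in>A. h (f x))"
  by (induction A rule: infinite_finite_induct) (simp_all add: hom_0 hom_add)

lemma hom_prod: "h (prod f A) = (\<Prod>x\<in>A. h (f x))"
  by (induction A rule: infinite_finite_induct) (simp_all add: hom_1 hom_mult)

lemma hom_power: "h (x ^ n) = h x ^ n"
  by (induction n) (simp_all add: hom_1 hom_mult)

lemma hom_of_nat: "h (of_nat n) = of_nat n"
  by (induction n) (simp_all add: hom_0 hom_1 hom_add)

lemma hom_of_int: "h (of_int n) = of_int n"
  by (cases n rule: int_cases2) (simp_all add: hom_of_nat hom_minus)

lemma hom_fgl_plus: "h (fgl_plus b x y) = fgl_plus (h b) (h x) (h y)"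
  by (simp add: fgl_plus_def hom_add hom_mult)

lemma hom_pfaffian: "h (pfaffian m a) = pfaffian m (\<lambda>i j. h (a i j))"
  by (simp add: pfaffian_def hom_sum hom_mult hom_of_int hom_prod)

end

interpretation to_fls: ring_morphism "fps_to_fls :: 'a::comm_ring_1 fps \<Rightarrow> 'a fls"
  by unfold_locales (simp_all add: fls_times_fps_to_fls)

lemma matchings_pair_in:
  assumes "s \<in> matchings m" "k \<in> {1..m}"
  shows "s (2*k-1) \<in> {1..2*m}" "s (2*k) \<in> {1..2*m}" "s (2*k-1) < s (2*k)"
proof -
  have "2*k-1 \<in> {1..2*m}" "2*k \<in> {1..2*m}" using assms(2) by auto
  then show "s (2*k-1) \<in> {1..2*m}" "s (2*k) \<in> {1..2*m}"
    by (simp_all only: permutes_in_image[OF matchings_permutes[OF assms(1)]])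
  show "s (2*k-1) < s (2*k)" using assms unfolding matchings_def by blast
qed

text \<open>Matchings read only entries above the diagonal. The restriction to i < j matters at the
  end, where it guarantees nonpositive exponents.\<close>

lemma pfaffian_cong:
  assumes "\<And>i j. i \<in> {1..2*m} \<Longrightarrow> j \<in> {1..2*m} \<Longrightarrow> i < j \<Longrightarrow> a i j = a' i j"
  shows "pfaffian m a = pfaffian m a'"
  unfolding pfaffian_matchings
  by (intro sum.cong refl arg_cong2[where f = "(*)"] prod.cong assms matchings_pair_in)

lemma prod_odd_even:
  fixes f :: "nat \<Rightarrow> 'a::comm_monoid_mult" and m :: nat
  shows "(\<Prod>k\<in>{1..m}. f (2*k-1) * f (2*k)) = (\<Prod>i\<in>{1..2*m}. f i)"
  by (induction m) (simp_all add: mult.assoc)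

text \<open>A matching uses every index exactly once, so all terms acquire the same factor.\<close>

lemma pfaffian_scale:
  "pfaffian m (\<lambda>i j. c i * c j * a i j) = (\<Prod>i\<in>{1..2*m}. c i) * pfaffian m a"
proof -
  have "(\<Prod>k\<in>{1..m}. c (s (2*k-1)) * c (s (2*k))) = (\<Prod>i\<in>{1..2*m}. c i)" if "s \<in> matchings m" for s
    using prod_odd_even[of "\<lambda>i. c (s i)" m] prod.permute[OF matchings_permutes[OF that], of c]
    by (simp add: o_def)
  then have "(\<Prod>k\<in>{1..m}. c (s (2*k-1)) * c (s (2*k)) * a (s (2*k-1)) (s (2*k)))
      = (\<Prod>i\<in>{1..2*m}. c i) * (\<Prod>k\<in>{1..m}. a (s (2*k-1)) (s (2*k)))" if "s \<in> matchings m" for s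
    using that by (subst prod.distrib) simp
  then show ?thesis
    unfolding pfaffian_matchings sum_distrib_left by (intro sum.cong refl) (simp only: mult.left_commute)
qed

text \<open>If two of the \<open>x k\<close> coincide the recursion above is not available; perturbing \<open>x k\<close> to
  \<open>x k + T ^ k\<close> makes them distinct, and the general case is recovered at \<open>T = 0\<close>.\<close>

lemma schur_pfaffian:
  fixes b :: "'a::field" and x :: "nat \<Rightarrow> 'a"
  assumes b: "b \<noteq> 0" and two: "(2::'a) \<noteq> 0"
    and x1: "\<And>k. k \<in> {1..2*m} \<Longrightarrow> 1 + b * x k \<noteq> 0"
    and xx: "\<And>j k. j \<in> {1..2*m} \<Longrightarrow> k \<in> {1..2*m} \<Longrightarrow> fgl_plus b (x j) (x k) \<noteq> 0"
  shows "pfaffian m (\<lambda>i j. (x j - x i) / fgl_plus b (x i) (x j))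
    = (\<Prod>(i,j)\<in>pairs {1..2*m}. (x j - x i) / fgl_plus b (x i) (x j))"
proof -
  define y where "y k = fps_const (x k) + fps_X ^ k" for k
  define Y where "Y k = fps_to_fls (y k)" for k
  define F where "F i j = (y j - y i) * inverse (fgl_plus (fps_const b) (y i) (y j))" for i j
  interpret nth0: ring_morphism "\<lambda>f::'a fps. fps_nth f 0"
    by unfold_locales simp_all
  have y0: "fps_nth (y k) 0 = x k" if "k \<in> {1..2*m}" for k
    using that by (simp add: y_def)
  have pl0: "fps_nth (fgl_plus (fps_const b) (y i) (y j)) 0 = fgl_plus b (x i) (x j)"
    if "i \<in> {1..2*m}" "j \<in> {1..2*m}" for i j
    using y0 that by (simp add: nth0.hom_fgl_plus)
  have F: "fps_to_fls (F i j) = (Y j - Y i) / fgl_plus (fls_const b) (Y i) (Y j)"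
    if "i \<in> {1..2*m}" "j \<in> {1..2*m}" for i j
  proof -
    \<comment> \<open>The denominator is nonzero at T = 0, so \<open>F i j\<close> is a genuine
      power series and can be evaluated there.\<close>
    have "subdegree (fgl_plus (fps_const b) (y i) (y j)) = 0"
      using pl0[OF that] xx[OF that] by (intro subdegree_eq_0) simp
    then show ?thesis unfolding F_def Y_def divide_inverse
      by (simp add: to_fls.hom_mult fls_inverse_fps_to_fls flip: fps_const_to_fls to_fls.hom_fgl_plus)
  qed
  have inj: "inj_on Y {1..2*m}"
  proof (rule inj_onI)
    fix i j assume "i \<in> {1..2*m}" "j \<in> {1..2*m}" "Y i = Y j"
    \<comment> \<open>The coefficient of T^i is 1 in \<open>y i\<close> and, as i > 0, nonzero in
      \<open>y j\<close> only for j = i.\<close>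
    then have "fps_nth (y i) i = fps_nth (y j) i" "i \<noteq> 0" by (simp_all add: Y_def)
    then show "i = j" by (simp add: y_def split: if_splits)
  qed
  have "fps_to_fls (pfaffian m F) = pfaffian m (\<lambda>i j. (Y j - Y i) / fgl_plus (fls_const b) (Y i) (Y j))"
    unfolding to_fls.hom_pfaffian by (rule pfaffian_cong) (rule F)
  also have "\<dots> = (\<Prod>(i,j)\<in>pairs {1..2*m}. (Y j - Y i) / fgl_plus (fls_const b) (Y i) (Y j))"
  proof (rule schur_pfaffian_distinct[OF _ _ inj])
    show "fls_const b \<noteq> 0" using b by simp
    show "(2::'a fls) \<noteq> 0" using two by (simp flip: fls_const_numeral)
  next
    fix k assume k: "k \<in> {1..2*m}"
    have "fps_nth (1 + fps_const b * y k) 0 \<noteq> 0" using y0[OF k] x1[OF k] by simp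
    then have "1 + fps_const b * y k \<noteq> 0" by (metis fps_zero_nth)
    then have "fps_to_fls (1 + fps_const b * y k) \<noteq> 0" by (simp only: fps_to_fls_eq_0_iff not_False_eq_True)
    then show "1 + fls_const b * Y k \<noteq> 0"
      by (simp only: Y_def to_fls.hom_mult to_fls.hom_add to_fls.hom_1 fps_const_to_fls not_False_eq_True)
  next
    fix j k assume jk: "j \<in> {1..2*m}" "k \<in> {1..2*m}"
    have "fgl_plus (fps_const b) (y j) (y k) \<noteq> 0" using pl0[OF jk] xx[OF jk] by (metis fps_zero_nth)
    then have "fps_to_fls (fgl_plus (fps_const b) (y j) (y k)) \<noteq> 0" by simp
    then show "fgl_plus (fls_const b) (Y j) (Y k) \<noteq> 0"
      by (simp add: Y_def to_fls.hom_fgl_plus)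
  qed
  also have "\<dots> = fps_to_fls (\<Prod>(i,j)\<in>pairs {1..2*m}. F i j)"
    unfolding to_fls.hom_prod by (intro prod.cong refl) (auto simp: F mem_pairs)
  finally have "pfaffian m F = (\<Prod>(i,j)\<in>pairs {1..2*m}. F i j)" by simp
  then have "fps_nth (pfaffian m F) 0 = fps_nth (\<Prod>(i,j)\<in>pairs {1..2*m}. F i j) 0" by simp
  moreover have F0: "fps_nth (F i j) 0 = (x j - x i) / fgl_plus b (x i) (x j)"
    if "i \<in> {1..2*m}" "j \<in> {1..2*m}" for i j
    unfolding F_def using y0 that pl0[OF that] by (simp add: divide_inverse)
  have "fps_nth (pfaffian m F) 0 = pfaffian m (\<lambda>i j. (x j - x i) / fgl_plus b (x i) (x j))"
    unfolding nth0.hom_pfaffian by (rule pfaffian_cong) (rule F0)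
  moreover have "fps_nth (\<Prod>(i,j)\<in>pairs {1..2*m}. F i j) 0
      = (\<Prod>(i,j)\<in>pairs {1..2*m}. (x j - x i) / fgl_plus b (x i) (x j))"
    unfolding nth0.hom_prod by (intro prod.cong refl) (auto simp: F0 mem_pairs)
  ultimately show ?thesis by simp
qed

text \<open>Mind the order of the arguments: \<open>fgl_ratio b x y\<close> is the quotient of the formal difference
  of \<open>y\<close> and \<open>x\<close> by their formal sum.\<close>

definition fgl_ratio :: "'a::field \<Rightarrow> 'a \<Rightarrow> 'a \<Rightarrow> 'a" where
  "fgl_ratio b x y = fgl_minus b y x / fgl_plus b y x"

lemma fgl_plus_commute: "fgl_plus b x y = fgl_plus b y x"
  by (simp add: fgl_plus_def algebra_simps)

lemma prod_pairs_fst: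
  "(\<Prod>(i,j)\<in>pairs {1..N}. g i) = (\<Prod>i\<in>{1..N}. g i ^ (N - i))"
proof -
  have "pairs {1..N} = (SIGMA i:{1..N}. {i<..N})" by (auto simp: pairs_def)
  then show ?thesis by (simp flip: prod.Sigma)
qed

lemma pfaffian_fgl_ratio:
  fixes b :: "'a::field" and x :: "nat \<Rightarrow> 'a"
  assumes b: "b \<noteq> 0" and two: "(2::'a) \<noteq> 0"
    and x1: "\<And>k. k \<in> {1..2*m} \<Longrightarrow> 1 + b * x k \<noteq> 0"
    and xx: "\<And>j k. j \<in> {1..2*m} \<Longrightarrow> k \<in> {1..2*m} \<Longrightarrow> fgl_plus b (x j) (x k) \<noteq> 0"
  shows "pfaffian m (\<lambda>i j. (1 + b * x i) powi (int i + 1 - 2 * int m) * (1 + b * x j) powi (int j - 2 * int m)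
      * fgl_ratio b (x i) (x j))
    = (\<Prod>(i,j)\<in>pairs {1..2*m}. fgl_ratio b (x i) (x j))"
proof -
  define c where "c i = (1 + b * x i) powi (int i - 2 * int m)" for i
  have ratio: "fgl_ratio b (x i) (x j) = inverse (1 + b * x i) * ((x j - x i) / fgl_plus b (x i) (x j))" for i j
    by (simp add: fgl_ratio_def fgl_minus_def fgl_plus_commute[of b "x j"] field_simps)
  have "(1 + b * x i) powi (int i + 1 - 2 * int m) = c i * (1 + b * x i)" if "i \<in> {1..2*m}" for i
    using power_int_add_1[of "1 + b * x i" "int i - 2 * int m"] x1[OF that] by (simp add: c_def algebra_simps)
  then have "pfaffian m (\<lambda>i j. (1 + b * x i) powi (int i + 1 - 2 * int m) * (1 + b * x j) powi (int j - 2 * int m)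
      * fgl_ratio b (x i) (x j)) = pfaffian m (\<lambda>i j. c i * c j * ((x j - x i) / fgl_plus b (x i) (x j)))"
    by (intro pfaffian_cong) (use x1 in \<open>simp add: ratio flip: c_def\<close>)
  also have "\<dots> = (\<Prod>i\<in>{1..2*m}. c i) * (\<Prod>(i,j)\<in>pairs {1..2*m}. (x j - x i) / fgl_plus b (x i) (x j))"
    using schur_pfaffian[OF b two x1 xx] by (simp only: pfaffian_scale)
  also have "(\<Prod>i\<in>{1..2*m}. c i) = (\<Prod>i\<in>{1..2*m}. inverse (1 + b * x i) ^ (2*m - i))"
  proof (intro prod.cong refl)
    fix i assume "i \<in> {1..2*m}"
    then have "int i - 2 * int m = - int (2*m - i)" by auto
    then show "c i = inverse (1 + b * x i) ^ (2*m - i)"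
      by (simp only: c_def power_int_minus power_int_of_nat power_inverse)
  qed
  also have "\<dots> = (\<Prod>(i,j)\<in>pairs {1..2*m}. inverse (1 + b * x i))"
    by (rule prod_pairs_fst[symmetric])
  finally show ?thesis by (simp add: ratio case_prod_unfold flip: prod.distrib)
qed

section \<open>Sums of Pfaffians and coset representatives\<close>

lemma sum_PiE_insert:
  assumes "x \<notin> S"
  shows "(\<Sum>g\<in>PiE (insert x S) T. F g) = (\<Sum>y\<in>T x. \<Sum>g\<in>PiE S T. F (g(x := y)))"
  unfolding PiE_insert_eq
  by (subst sum.reindex[OF inj_combinator[OF assms]]) (simp add: sum.cartesian_product case_prod_unfold)

text \<open>This is the case of the matching that pairs neighbours; any other matching is reduced to
  it by precomposing \<open>g\<close> with the permutation.\<close>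

lemma sum_PiE_pairs:
  fixes f :: "nat \<Rightarrow> 'b \<Rightarrow> 'b \<Rightarrow> 'a::comm_semiring_1" and m :: nat
  shows "(\<Sum>g\<in>{1..2*m} \<rightarrow>\<^sub>E A. \<Prod>k\<in>{1..m}. f k (g (2*k-1)) (g (2*k)))
    = (\<Prod>k\<in>{1..m}. \<Sum>p\<in>A. \<Sum>q\<in>A. f k p q)"
proof (induction m)
  case 0
  show ?case by simp
next
  case (Suc m)
  let ?a = "2 * m + 1" and ?b = "2 * m + 2"
  have "{1..2*Suc m} = insert ?b (insert ?a {1..2*m})" by auto
  then have "(\<Sum>g\<in>{1..2*Suc m} \<rightarrow>\<^sub>E A. \<Prod>k\<in>{1..Suc m}. f k (g (2*k-1)) (g (2*k)))
    = (\<Sum>q\<in>A. \<Sum>p\<in>A. \<Sum>g\<in>{1..2*m} \<rightarrow>\<^sub>E A.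
        \<Prod>k\<in>{1..Suc m}. f k ((g(?a := p, ?b := q)) (2*k-1)) ((g(?a := p, ?b := q)) (2*k)))"
    by (simp only:) (subst sum_PiE_insert, simp, subst sum_PiE_insert, simp_all)
  also have "\<dots> = (\<Sum>q\<in>A. \<Sum>p\<in>A. \<Sum>g\<in>{1..2*m} \<rightarrow>\<^sub>E A.
        f (Suc m) p q * (\<Prod>k\<in>{1..m}. f k (g (2*k-1)) (g (2*k))))"
  proof (intro sum.cong refl)
    fix q p g
    have "(\<Prod>k\<in>{1..m}. f k ((g(?a := p, ?b := q)) (2*k-1)) ((g(?a := p, ?b := q)) (2*k)))
       = (\<Prod>k\<in>{1..m}. f k (g (2*k-1)) (g (2*k)))"
      by (intro prod.cong refl) auto
    then show "(\<Prod>k\<in>{1..Suc m}. f k ((g(?a := p, ?b := q)) (2*k-1)) ((g(?a := p, ?b := q)) (2*k)))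
      = f (Suc m) p q * (\<Prod>k\<in>{1..m}. f k (g (2*k-1)) (g (2*k)))"
      by (simp add: mult.commute)
  qed
  also have "\<dots> = (\<Sum>q\<in>A. \<Sum>p\<in>A. f (Suc m) p q) * (\<Prod>k\<in>{1..m}. \<Sum>p\<in>A. \<Sum>q\<in>A. f k p q)"
    by (simp only: sum_distrib_left[symmetric] sum_distrib_right[symmetric] Suc.IH)
  also have "(\<Sum>q\<in>A. \<Sum>p\<in>A. f (Suc m) p q) = (\<Sum>p\<in>A. \<Sum>q\<in>A. f (Suc m) p q)"
    by (rule sum.swap)
  finally show ?case by (simp add: mult.commute)
qed

lemma bij_betw_PiE_compose:
  assumes "s permutes S"
  shows "bij_betw (\<lambda>g. g \<circ> s) (S \<rightarrow>\<^sub>E A) (S \<rightarrow>\<^sub>E A)"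
proof (rule bij_betwI[where g = "\<lambda>g. g \<circ> inv s"])
  have *: "g \<circ> t \<in> S \<rightarrow>\<^sub>E A" if "t permutes S" "g \<in> S \<rightarrow>\<^sub>E A" for t g
    using that permutes_in_image[OF that(1)]
    by (auto simp: PiE_iff extensional_def)
  show "(\<lambda>g. g \<circ> s) \<in> (S \<rightarrow>\<^sub>E A) \<rightarrow> S \<rightarrow>\<^sub>E A" "(\<lambda>g. g \<circ> inv s) \<in> (S \<rightarrow>\<^sub>E A) \<rightarrow> S \<rightarrow>\<^sub>E A"
    using *[OF assms] *[OF permutes_inv[OF assms]] by blast+
  show "g \<circ> s \<circ> inv s = g" "g \<circ> inv s \<circ> s = g" for g :: "'a \<Rightarrow> 'b"
    using permutes_inv_o[OF assms] by (simp_all add: o_assoc[symmetric])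
qed

lemma sum_pfaffian_PiE:
  fixes a :: "nat \<Rightarrow> nat \<Rightarrow> 'b \<Rightarrow> 'b \<Rightarrow> 'a::comm_ring_1"
  shows "(\<Sum>g\<in>{1..2*m} \<rightarrow>\<^sub>E A. pfaffian m (\<lambda>i j. a i j (g i) (g j)))
    = pfaffian m (\<lambda>i j. \<Sum>p\<in>A. \<Sum>q\<in>A. a i j p q)"
proof -
  have *: "(\<Sum>g\<in>{1..2*m} \<rightarrow>\<^sub>E A. \<Prod>k\<in>{1..m}. a (s (2*k-1)) (s (2*k)) (g (s (2*k-1))) (g (s (2*k))))
     = (\<Prod>k\<in>{1..m}. \<Sum>p\<in>A. \<Sum>q\<in>A. a (s (2*k-1)) (s (2*k)) p q)" if "s \<in> matchings m" for s
    using sum.reindex_bij_betw[OF bij_betw_PiE_compose[OF matchings_permutes[OF that]],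
        of "\<lambda>g. \<Prod>k\<in>{1..m}. a (s (2*k-1)) (s (2*k)) (g (2*k-1)) (g (2*k))" A]
      sum_PiE_pairs[of "\<lambda>k. a (s (2*k-1)) (s (2*k))" m A] by simp
  show ?thesis
    unfolding pfaffian_matchings
    by (subst sum.swap) (intro sum.cong refl, simp only: sum_distrib_left[symmetric] *)
qed

text \<open>A representative is determined by its values at the first r positions, since the
  remaining values are the complement in increasing order. Positions are shifted to
  \<open>{1..r}\<close> to agree with the indices of \<open>pfaffian\<close>.\<close>

lemma coset_reps_restrict_bij:
  assumes "r \<le> n"
  shows "bij_betw (\<lambda>w. \<lambda>i\<in>{1..r}. w (i - 1)) (coset_reps n r)
    {g \<in> {1..r} \<rightarrow>\<^sub>E {..<n}. inj_on g {1..r}}"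
  unfolding bij_betw_def
proof
  let ?R = "\<lambda>w::nat \<Rightarrow> nat. \<lambda>i\<in>{1..r}. w (i - 1)"
  have split: "{0..<n} = {0..<r} \<union> {r..<n}" using assms by auto
  show "inj_on ?R (coset_reps n r)"
  proof (rule inj_onI)
    fix w w' assume w: "w \<in> coset_reps n r" and w': "w' \<in> coset_reps n r" and eq: "?R w = ?R w'"
    have p: "w permutes {0..<n}" "w' permutes {0..<n}" using w w' by (auto simp: coset_reps_def)
    have low: "w i = w' i" if "i < r" for i
      using fun_cong[OF eq, of "Suc i"] that by simp
    \<comment> \<open>The tail of a representative is a sorted distinct list, hence determined by
      its set, and that set depends only on the first r values.\<close>
    have srt: "sorted (map v [r..<n]) \<and> distinct (map v [r..<n])
        \<and> set (map v [r..<n]) = {0..<n} - v ` {0..<r}" if "v \<in> coset_reps n r" for v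
    proof -
      have v: "v permutes {0..<n}" using that by (auto simp: coset_reps_def)
      have "v ` {r..<n} = v ` ({0..<n} - {0..<r})" using assms by (intro arg_cong[of _ _ "image v"]) auto
      also have "\<dots> = {0..<n} - v ` {0..<r}"
        using permutes_inj[OF v] permutes_image[OF v] by (subst image_set_diff) simp_all
      finally have "v ` {r..<n} = {0..<n} - v ` {0..<r}" .
      moreover have "sorted (map v [r..<n])"
        using that unfolding sorted_map sorted_wrt_iff_nth_less
        by (auto simp: coset_reps_def intro!: less_imp_le)
      ultimately show ?thesis
        using permutes_inj_on[OF v] by (simp add: distinct_map)
    qed
    have "w ` {0..<r} = w' ` {0..<r}" using low by auto
    then have "map w [r..<n] = map w' [r..<n]"
      using srt[OF w] srt[OF w'] by (intro sorted_distinct_set_unique) auto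
    then have "w i = w' i" if "r \<le> i" "i < n" for i using that by auto
    moreover have "w i = w' i" if "\<not> i < n" for i using p that by (simp add: permutes_not_in)
    ultimately show "w = w'" using low by (metis ext not_le)
  qed
  show "?R ` coset_reps n r = {g \<in> {1..r} \<rightarrow>\<^sub>E {..<n}. inj_on g {1..r}}"
  proof (intro equalityI subsetI)
    fix g assume "g \<in> ?R ` coset_reps n r"
    then obtain w where w: "w \<in> coset_reps n r" and g: "g = ?R w" by blast
    have p: "w permutes {0..<n}" using w by (auto simp: coset_reps_def)
    have "w (i - 1) < n" if "i \<in> {1..r}" for i
      using permutes_in_image[OF p, of "i - 1"] that assms by auto
    then have "g \<in> {1..r} \<rightarrow>\<^sub>E {..<n}" by (auto simp: g)
    moreover have "inj_on g {1..r}"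
    proof (rule inj_onI)
      fix i j assume ij: "i \<in> {1..r}" "j \<in> {1..r}" "g i = g j"
      then have "w (i - 1) = w (j - 1)" by (simp add: g)
      then have "i - 1 = j - 1" by (rule injD[OF permutes_inj[OF p]])
      with ij show "i = j" by auto
    qed
    ultimately show "g \<in> {g \<in> {1..r} \<rightarrow>\<^sub>E {..<n}. inj_on g {1..r}}" by simp
  next
    fix g assume "g \<in> {g \<in> {1..r} \<rightarrow>\<^sub>E {..<n}. inj_on g {1..r}}"
    then have g: "g \<in> {1..r} \<rightarrow>\<^sub>E {..<n}" and inj: "inj_on g {1..r}" by auto
    define C where "C = {0..<n} - g ` {1..r}"
    have "g ` {1..r} \<subseteq> {0..<n}" using g by (auto dest: PiE_mem)
    then have cardC: "card C = n - r" using inj by (simp add: C_def card_Diff_subset card_image)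
    define L where "L = sorted_list_of_set C"
    have L: "set L = C" "length L = n - r" "sorted_wrt (<) L" "distinct L"
      using cardC by (simp_all add: L_def C_def)
    define w where "w i = (if i < r then g (Suc i) else if i < n then L ! (i - r) else i)" for i
    have wC: "w i \<in> C" if "r \<le> i" "i < n" for i
    proof -
      have "L ! (i - r) \<in> set L" using that L(2) by (intro nth_mem) simp
      then show ?thesis using that L(1) by (simp add: w_def)
    qed
    have wg: "w i \<in> g ` {1..r}" if "i < r" for i using that by (auto simp: w_def)
    have "inj_on w {0..<n}"
    proof (rule linorder_inj_onI')
      fix i j assume ij: "i \<in> {0..<n}" "j \<in> {0..<n}" "i < j"
      consider "j < r" | "i < r" "r \<le> j" | "r \<le> i" using ij by linarith
      then show "w i \<noteq> w j"
      proof cases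
        case 1
        then show ?thesis using ij inj_onD[OF inj, of "Suc i" "Suc j"] by (auto simp: w_def)
      next
        case 2
        then show ?thesis using wg[of i] wC[of j] ij by (auto simp: C_def)
      next
        case 3
        then show ?thesis using ij L by (auto simp: w_def nth_eq_iff_index_eq)
      qed
    qed
    moreover have "w ` {0..<n} \<subseteq> {0..<n}"
      using wC g assms by (force simp: w_def C_def)
    ultimately have "bij_betw w {0..<n} {0..<n}"
      by (simp add: bij_betw_def endo_inj_surj)
    then have "w permutes {0..<n}"
      by (rule bij_imp_permutes) (use assms in \<open>auto simp: w_def\<close>)
    moreover have "w i < w j" if "r \<le> i" "i < j" "j < n" for i j
      using that L(2) sorted_wrt_nth_less[OF L(3), of "i - r" "j - r"] by (simp add: w_def)
    ultimately have "w \<in> coset_reps n r" by (simp add: coset_reps_def)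
    moreover have "g = ?R w"
      using g by (auto simp: w_def fun_eq_iff PiE_iff extensional_def)
    ultimately show "g \<in> ?R ` coset_reps n r" by blast
  qed
qed

section \<open>The ground field: beta, 2 and the variables are nonzero, and the variables are
  distinct\<close>

lemma single_neq_0: "v \<noteq> 0 \<Longrightarrow> Poly_Mapping.single k v \<noteq> 0"
  by (metis lookup_single_eq lookup_zero)

lemma beta_neq_0: "beta \<noteq> 0"
  by (simp add: beta_def Zero_fract_def eq_fract single_neq_0)

lemma Xvar_neq_0: "Xvar i \<noteq> 0"
  by (simp add: Xvar_def Zero_fract_def eq_fract single_neq_0)

lemma Xvar_inj: "Xvar i = Xvar j \<Longrightarrow> i = j"
proof -
  assume "Xvar i = Xvar j"
  then have "Poly_Mapping.single (Poly_Mapping.single i (1::nat)) (1::int poly) = Poly_Mapping.single (Poly_Mapping.single j 1) 1"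
    by (simp add: Xvar_def eq_fract)
  then have "Poly_Mapping.keys (Poly_Mapping.single (Poly_Mapping.single i (1::nat)) (1::int poly))
      = Poly_Mapping.keys (Poly_Mapping.single (Poly_Mapping.single j (1::nat)) (1::int poly))" by (rule arg_cong)
  then have "Poly_Mapping.single i (1::nat) = Poly_Mapping.single j 1" unfolding keys_single by simp
  then have "Poly_Mapping.keys (Poly_Mapping.single i (1::nat)) = Poly_Mapping.keys (Poly_Mapping.single j (1::nat))"
    by (rule arg_cong)
  then show "i = j" unfolding keys_single by simp
qed

lemma coef_two_neq_0: "(2::coef) \<noteq> 0"
proof
  assume "(2::coef) = 0"
  then have "(1::coef) + 1 = 0" by simp
  then have "Fraction_Field.Fract (1 :: mpoly) 1 + Fraction_Field.Fract 1 1 = Fraction_Field.Fract 0 1"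
    unfolding One_fract_def Zero_fract_def .
  then have "(1::mpoly) + 1 = 0" by (simp add: eq_fract)
  then show False by simp
qed

section \<open>The symmetrization formula\<close>

lemma fgl_minus_to_fls:
  fixes f y :: "'a::field fps"
  assumes "fps_nth y 0 = 0"
  shows "fps_to_fls (fgl_minus (fps_const b) f y) = fgl_minus (fls_const b) (fps_to_fls f) (fps_to_fls y)"
proof -
  have s: "subdegree (1 + fps_const b * y) = 0" by (rule subdegree_eq_0) (simp add: assms)
  have "fps_to_fls ((f - y) / (1 + fps_const b * y)) = fps_to_fls (f - y) / fps_to_fls (1 + fps_const b * y)"
    by (rule fls_divide_fps_to_fls[symmetric]) (simp add: s)
  then show ?thesis
    by (simp only: fgl_minus_def to_fls.hom_diff to_fls.hom_add to_fls.hom_1 to_fls.hom_mult fps_const_to_fls)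
qed

text \<open>Used at two levels: over \<open>coef\<close>, with \<open>u2\<close> as auxiliary
  variable, and over the Laurent series in \<open>u2\<close>, with \<open>u1\<close> as auxiliary
  variable.\<close>

locale fgl_variables =
  fixes b :: "'k::field" and X :: "nat \<Rightarrow> 'k"
  assumes b_neq_0: "b \<noteq> 0" and X_neq_0: "X p \<noteq> 0" and X_inj: "X p = X q \<Longrightarrow> p = q"
begin

definition x :: "nat \<Rightarrow> 'k fps" where "x p = fps_const (X p) * fps_X"

abbreviation xl :: "nat \<Rightarrow> 'k fls" where "xl p \<equiv> fps_to_fls (x p)"

abbreviation plus :: "nat \<Rightarrow> nat \<Rightarrow> 'k fps" where
  "plus p q \<equiv> fgl_plus (fps_const b) (x p) (x q)"

abbreviation minus :: "nat \<Rightarrow> nat \<Rightarrow> 'k fps" where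
  "minus p q \<equiv> fgl_minus (fps_const b) (x p) (x q)"

text \<open>The residue at \<open>u = x q\<close> of the generating function in the variables indexed by \<open>S\<close>.\<close>

definition residue :: "nat set \<Rightarrow> nat \<Rightarrow> 'k fps" where
  "residue S q = plus q q * (\<Prod>j\<in>S-{q}. plus q j / minus q j)"

lemma x_nth_0: "fps_nth (x p) 0 = 0"
  by (simp add: x_def)

lemma x_nth_1: "fps_nth (x p) (Suc 0) = X p"
  by (simp add: x_def)

lemma minus_nth_1: "fps_nth (minus p q) (Suc 0) = X p - X q"
proof -
  have "minus p q = (x p - x q) * inverse (1 + fps_const b * x q)"
    unfolding fgl_minus_def by (rule fps_divide_unit) (simp add: x_nth_0)
  also have "\<dots> = fps_X * (fps_const (X p - X q) * inverse (1 + fps_const b * x q))"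
    by (simp add: x_def algebra_simps flip: fps_const_sub)
  finally show ?thesis by (simp add: x_nth_0)
qed

text \<open>The coefficient \<open>X p + X q\<close> of t is not known to be nonzero in the locale,
  so the coefficient of t^2 serves as witness.\<close>

lemma plus_neq_0: "plus p q \<noteq> 0"
proof -
  have "fps_nth (plus p q) 2 = b * X p * X q"
    by (simp add: fgl_plus_def x_def numeral_2_eq_2 mult.assoc)
  then show ?thesis using b_neq_0 X_neq_0 by (metis fps_zero_nth mult_eq_0_iff)
qed

lemma minus_neq_0: "p \<noteq> q \<Longrightarrow> minus p q \<noteq> 0"
  using minus_nth_1[of p q] X_inj[of p q] by (metis eq_iff_diff_eq_0 fps_zero_nth)

text \<open>Formal sums have order at least 1 in t and formal differences of distinct variables
  order at most 1, so the quotients in \<open>residue\<close> are power series and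
  \<open>fps_to_fls\<close> respects the division.\<close>

lemma minus_dvd_plus_subdegree:
  assumes "p \<noteq> q"
  shows "subdegree (minus p q) \<le> subdegree (plus p' q')"
proof -
  have "subdegree (minus p q) \<le> 1"
    using minus_nth_1[of p q] X_inj[of p q] assms by (intro subdegree_leI) auto
  also have "1 \<le> subdegree (plus p' q')"
    by (rule subdegree_geI) (use plus_neq_0 in \<open>auto simp: fgl_plus_def x_nth_0\<close>)
  finally show ?thesis .
qed

lemma plus_to_fls: "fps_to_fls (plus p q) = fgl_plus (fls_const b) (xl p) (xl q)"
  by (simp add: to_fls.hom_fgl_plus)

lemma one_plus_to_fls: "fps_to_fls (1 + fps_const b * x p) = 1 + fls_const b * xl p"
  by (simp only: to_fls.hom_add to_fls.hom_1 to_fls.hom_mult fps_const_to_fls)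

lemma one_plus_neq_0: "1 + fls_const b * xl p \<noteq> 0"
proof -
  have "fps_nth (1 + fps_const b * x p) 0 \<noteq> 0" by (simp add: x_nth_0)
  then have "1 + fps_const b * x p \<noteq> 0" by (metis fps_zero_nth)
  then show ?thesis unfolding one_plus_to_fls[symmetric] by (simp only: fps_to_fls_eq_0_iff not_False_eq_True)
qed

lemma minus_to_fls: "fps_to_fls (minus p q) = fgl_minus (fls_const b) (xl p) (xl q)"
  by (rule fgl_minus_to_fls) (rule x_nth_0)

lemma ratio_to_fls:
  "p \<noteq> q \<Longrightarrow> fps_to_fls (plus p q / minus p q)
    = fgl_plus (fls_const b) (xl p) (xl q) / fgl_minus (fls_const b) (xl p) (xl q)"
  unfolding plus_to_fls[symmetric] minus_to_fls[symmetric]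
  by (rule fls_divide_fps_to_fls[symmetric, OF minus_dvd_plus_subdegree])

lemma residue_to_fls:
  "fps_to_fls (residue S q) = fgl_plus (fls_const b) (xl q) (xl q) *
     (\<Prod>j\<in>S-{q}. fgl_plus (fls_const b) (xl q) (xl j) / fgl_minus (fls_const b) (xl q) (xl j))"
  unfolding residue_def to_fls.hom_mult to_fls.hom_prod plus_to_fls
  by (intro arg_cong2[where f = "(*)"] prod.cong refl ratio_to_fls) auto

end

lemma prod_pairs_swap:
  fixes r :: nat
  shows "(\<Prod>i<r. \<Prod>j<i. F j i) = (\<Prod>(j,i)\<in>pairs {..<r}. F j i)"
proof -
  have "(\<Prod>i<r. \<Prod>j<i. F j i) = (\<Prod>(i,j)\<in>(SIGMA i:{..<r}. {..<i}). F j i)"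
    by (simp add: prod.Sigma)
  also have "\<dots> = (\<Prod>(j,i)\<in>pairs {..<r}. F j i)"
    by (rule prod.reindex_bij_witness[of _ prod.swap prod.swap]) (auto simp: pairs_def)
  finally show ?thesis .
qed

text \<open>The factors with j > i are completed to all variables other than that of
  \<open>w i\<close>, which makes the first product depend on \<open>w i\<close> alone; the added
  factors, with j < i, are divided out again as a product over pairs.\<close>

lemma prod_later_positions:
  fixes R :: "nat \<Rightarrow> nat \<Rightarrow> 'a::field"
  assumes w: "w permutes {..<n}" and r: "r \<le> n" and R: "\<And>p q. p \<noteq> q \<Longrightarrow> R p q \<noteq> 0"
  shows "(\<Prod>i<r. \<Prod>j\<in>{i+1..<n}. R (w i) (w j))
    = (\<Prod>i<r. \<Prod>q\<in>{..<n}-{w i}. R (w i) q) * (\<Prod>(i,j)\<in>pairs {..<r}. inverse (R (w j) (w i)))"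
proof -
  have "(\<Prod>j\<in>{i+1..<n}. R (w i) (w j)) = (\<Prod>q\<in>{..<n}-{w i}. R (w i) q) * (\<Prod>j<i. inverse (R (w i) (w j)))"
    if "i < r" for i
  proof -
    have "bij_betw w ({..<n} - {i}) ({..<n} - {w i})"
      using permutes_imp_bij[OF w] that r by (intro bij_betw_DiffI) (auto simp: bij_betw_def)
    then have "(\<Prod>q\<in>{..<n}-{w i}. R (w i) q) = (\<Prod>j\<in>{..<n}-{i}. R (w i) (w j))"
      by (rule prod.reindex_bij_betw[symmetric])
    also have "{..<n} - {i} = {..<i} \<union> {i+1..<n}" using that r by auto
    also have "(\<Prod>j\<in>{..<i} \<union> {i+1..<n}. R (w i) (w j)) = (\<Prod>j<i. R (w i) (w j)) * (\<Prod>j\<in>{i+1..<n}. R (w i) (w j))"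
      by (rule prod.union_disjoint) auto
    finally have "(\<Prod>q\<in>{..<n}-{w i}. R (w i) q) = (\<Prod>j<i. R (w i) (w j)) * (\<Prod>j\<in>{i+1..<n}. R (w i) (w j))" .
    moreover have "R (w i) (w j) \<noteq> 0" if "j < i" for j
      using R permutes_inj[OF w] that by (metis injD nat_neq_iff)
    then have "(\<Prod>j<i. R (w i) (w j)) \<noteq> 0" by simp
    moreover have "(\<Prod>j<i. inverse (R (w i) (w j))) = inverse (\<Prod>j<i. R (w i) (w j))"
      by (simp only: prod_inversef[symmetric] o_def)
    ultimately show ?thesis by simp
  qed
  then have "(\<Prod>i<r. \<Prod>j\<in>{i+1..<n}. R (w i) (w j))
    = (\<Prod>i<r. (\<Prod>q\<in>{..<n}-{w i}. R (w i) q) * (\<Prod>j<i. inverse (R (w i) (w j))))"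
    by (intro prod.cong) auto
  also have "\<dots> = (\<Prod>i<r. \<Prod>q\<in>{..<n}-{w i}. R (w i) q) * (\<Prod>i<r. \<Prod>j<i. inverse (R (w i) (w j)))"
    by (rule prod.distrib)
  finally show ?thesis unfolding prod_pairs_swap .
qed

interpretation V: fgl_variables beta Xvar
  by unfold_locales (rule beta_neq_0 Xvar_neq_0 Xvar_inj, assumption?)+

lemma xvar_eq: "xvar = V.x"
  by (simp add: fun_eq_iff xvar_def V.x_def)

lemma GQ_summand_to_fls:
  assumes w: "w permutes {..<n}" and r: "length nu \<le> n"
  shows "fps_to_fls (GQ_summand n nu (\<lambda>i. xvar (w i)))
    = (\<Prod>i<length nu. fps_to_fls (V.residue {..<n} (w i)) * V.xl (w i) ^ (nu ! i - 1)) *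
      (\<Prod>(i,j)\<in>pairs {..<length nu}. fgl_ratio (fls_const beta) (V.xl (w i)) (V.xl (w j)))"
proof -
  define R where "R p q = fgl_plus (fls_const beta) (V.xl p) (V.xl q) / fgl_minus (fls_const beta) (V.xl p) (V.xl q)" for p q
  have R: "R p q \<noteq> 0" if "p \<noteq> q" for p q
    using that V.plus_neq_0 V.minus_neq_0
    by (simp add: R_def flip: V.plus_to_fls V.minus_to_fls)
  have "fps_to_fls (GQ_summand n nu (\<lambda>i. xvar (w i)))
    = (\<Prod>i<length nu. fps_to_fls (V.plus (w i) (w i)) * V.xl (w i) ^ (nu ! i - 1)) *
      (\<Prod>i<length nu. \<Prod>j\<in>{i+1..<n}. fps_to_fls (V.plus (w i) (w j) / V.minus (w i) (w j)))"
    by (simp add: GQ_summand_def oplus_def ominus_def xvar_eq to_fls.hom_mult to_fls.hom_prod to_fls.hom_power)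
  also have "(\<Prod>i<length nu. \<Prod>j\<in>{i+1..<n}. fps_to_fls (V.plus (w i) (w j) / V.minus (w i) (w j)))
    = (\<Prod>i<length nu. \<Prod>j\<in>{i+1..<n}. R (w i) (w j))"
  proof (intro prod.cong refl)
    fix i j assume "j \<in> {i+1..<n}"
    then have "w i \<noteq> w j" using permutes_inj[OF w] by (metis atLeastLessThan_iff injD not_less_eq_eq Suc_eq_plus1 order_refl)
    then show "fps_to_fls (V.plus (w i) (w j) / V.minus (w i) (w j)) = R (w i) (w j)"
      unfolding R_def by (rule V.ratio_to_fls)
  qed
  also have "\<dots> = (\<Prod>i<length nu. \<Prod>q\<in>{..<n}-{w i}. R (w i) q) * (\<Prod>(i,j)\<in>pairs {..<length nu}. inverse (R (w j) (w i)))"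
    by (rule prod_later_positions[OF w r R])
  also have "(\<Prod>(i,j)\<in>pairs {..<length nu}. inverse (R (w j) (w i)))
    = (\<Prod>(i,j)\<in>pairs {..<length nu}. fgl_ratio (fls_const beta) (V.xl (w i)) (V.xl (w j)))"
    by (simp add: R_def fgl_ratio_def)
  finally show ?thesis
    by (simp add: prod.distrib V.residue_to_fls V.plus_to_fls R_def mult_ac)
qed

lemma GQ_to_fls:
  fixes nu n
  defines "r \<equiv> length nu"
  assumes r: "r \<le> n"
  shows "fps_to_fls (GQ n nu) = (\<Sum>g\<in>{1..r} \<rightarrow>\<^sub>E {..<n}.
      (\<Prod>i\<in>{1..r}. fps_to_fls (V.residue {..<n} (g i)) * V.xl (g i) ^ (nu ! (i - 1) - 1)) *
      (\<Prod>(i,j)\<in>pairs {1..r}. fgl_ratio (fls_const beta) (V.xl (g i)) (V.xl (g j))))"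
proof -
  define P where "P g = (\<Prod>i\<in>{1..r}. fps_to_fls (V.residue {..<n} (g i)) * V.xl (g i) ^ (nu ! (i - 1) - 1)) *
      (\<Prod>(i,j)\<in>pairs {1..r}. fgl_ratio (fls_const beta) (V.xl (g i)) (V.xl (g j)))" for g
  \<comment> \<open>Positions count from 0 in \<open>GQ_summand\<close> but from 1 in
    \<open>pfaffian\<close>.\<close>
  have bij: "bij_betw Suc {..<r} {1..r}" by (rule bij_betwI[where g = "\<lambda>i. i - 1"]) auto
  have "fps_to_fls (GQ_summand n nu (\<lambda>i. xvar (w i))) = P (\<lambda>i\<in>{1..r}. w (i - 1))"
    if "w \<in> coset_reps n r" for w
  proof -
    have w: "w permutes {..<n}" using that by (simp add: coset_reps_def atLeast0LessThan)
    have "P (\<lambda>i\<in>{1..r}. w (i - 1)) = P (\<lambda>i. w (i - 1))"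
      unfolding P_def by (intro arg_cong2[where f = "(*)"] prod.cong refl) (auto simp: mem_pairs)
    also have "\<dots> = fps_to_fls (GQ_summand n nu (\<lambda>i. xvar (w i)))"
      unfolding GQ_summand_to_fls[OF w r[unfolded r_def]] r_def[symmetric] P_def
      using prod_pairs_reindex[OF bij, of "\<lambda>i j. fgl_ratio (fls_const beta) (V.xl (w (i - 1))) (V.xl (w (j - 1)))"]
        prod.reindex_bij_betw[OF bij, of "\<lambda>i. fps_to_fls (V.residue {..<n} (w (i - 1))) * V.xl (w (i - 1)) ^ (nu ! (i - 1) - 1)"]
      by simp
    finally show ?thesis by simp
  qed
  then have "fps_to_fls (GQ n nu) = (\<Sum>w\<in>coset_reps n r. P (\<lambda>i\<in>{1..r}. w (i - 1)))"
    unfolding GQ_def to_fls.hom_sum r_def[symmetric] by (rule sum.cong[OF refl])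
  also have "\<dots> = (\<Sum>g\<in>{g \<in> {1..r} \<rightarrow>\<^sub>E {..<n}. inj_on g {1..r}}. P g)"
    by (rule sum.reindex_bij_betw[OF coset_reps_restrict_bij[OF r]])
  also have "\<dots> = (\<Sum>g\<in>{1..r} \<rightarrow>\<^sub>E {..<n}. P g)"
  proof (rule sum.mono_neutral_left)
    show "finite ({1..r} \<rightarrow>\<^sub>E {..<n})" by (intro finite_PiE) auto
    show "\<forall>g\<in>({1..r} \<rightarrow>\<^sub>E {..<n}) - {g \<in> {1..r} \<rightarrow>\<^sub>E {..<n}. inj_on g {1..r}}. P g = 0"
    proof
      fix g assume "g \<in> ({1..r} \<rightarrow>\<^sub>E {..<n}) - {g \<in> {1..r} \<rightarrow>\<^sub>E {..<n}. inj_on g {1..r}}"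
      then have "\<not> inj_on g {1..r}" by auto
      then obtain i j where ij: "i \<in> {1..r}" "j \<in> {1..r}" "i < j" "g i = g j"
        using linorder_inj_onI'[of "{1..r}" g] by blast
      have "(\<Prod>(i,j)\<in>pairs {1..r}. fgl_ratio (fls_const beta) (V.xl (g i)) (V.xl (g j))) = 0"
        by (rule prod_zero) (use ij in \<open>auto simp: finite_pairs mem_pairs fgl_ratio_def fgl_minus_def intro!: bexI[of _ "(i, j)"]\<close>)
      then show "P g = 0" by (simp add: P_def)
    qed
  qed auto
  finally show ?thesis by (simp add: P_def)
qed

lemma GQ_pfaffian_to_fls:
  assumes len: "length nu = 2 * m" and n: "2 * m \<le> n"
  shows "fps_to_fls (GQ n nu) = pfaffian m (\<lambda>i j. \<Sum>p<n. \<Sum>q<n.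
      (fps_to_fls (V.residue {..<n} p) * V.xl p ^ (nu ! (i - 1) - 1)) *
      (fps_to_fls (V.residue {..<n} q) * V.xl q ^ (nu ! (j - 1) - 1)) *
      ((1 + fls_const beta * V.xl p) powi (int i + 1 - 2 * int m) *
       (1 + fls_const beta * V.xl q) powi (int j - 2 * int m) *
       fgl_ratio (fls_const beta) (V.xl p) (V.xl q)))"
proof -
  have two: "(2::coef fls) \<noteq> 0"
    using coef_two_neq_0 by (metis fls_const_nonzero fls_const_numeral)
  have "pfaffian m (\<lambda>i j. (1 + fls_const beta * V.xl (g i)) powi (int i + 1 - 2 * int m) *
       (1 + fls_const beta * V.xl (g j)) powi (int j - 2 * int m) *
       fgl_ratio (fls_const beta) (V.xl (g i)) (V.xl (g j)))
     = (\<Prod>(i,j)\<in>pairs {1..2*m}. fgl_ratio (fls_const beta) (V.xl (g i)) (V.xl (g j)))" for g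
    by (rule pfaffian_fgl_ratio)
       (use two V.one_plus_neq_0 beta_neq_0 V.plus_neq_0 in \<open>auto simp flip: V.plus_to_fls\<close>)
  then show ?thesis
    unfolding GQ_to_fls[OF n[folded len]] len sum_pfaffian_PiE[symmetric] pfaffian_scale
    by simp
qed

section \<open>Partial fractions and Laurent coefficients\<close>

text \<open>The residues at v, at w = -1/b and at the \<open>y p\<close> sum to 0. The node w is the
  pole of the prefactor 1 / (1 + b u) of G; without it the numerator would have too large a
  degree.\<close>

lemma partial_fractions_fgl:
  fixes b v :: "'a::field" and y :: "nat \<Rightarrow> 'a"
  assumes S: "finite S" and inj: "inj_on y S" and b: "b \<noteq> 0" and v: "1 + b * v \<noteq> 0"
    and y: "\<And>p. p \<in> S \<Longrightarrow> 1 + b * y p \<noteq> 0" and vy: "\<And>p. p \<in> S \<Longrightarrow> v \<noteq> y p"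
  shows "inverse (1 + b * v) * (\<Prod>j\<in>S. fgl_plus b v (y j) / fgl_minus b v (y j))
    = inverse (1 + b * v) + (\<Sum>p\<in>S. fgl_plus b (y p) (y p) *
        (\<Prod>j\<in>S-{p}. fgl_plus b (y p) (y j) / fgl_minus b (y p) (y j)) * inverse (v - y p))"
proof -
  define w where "w = - inverse b"
  have bw: "b * w = -1" using b by (simp add: w_def)
  have xw: "b * (x - w) = 1 + b * x" for x using bw by (simp add: right_diff_distrib)
  have vw: "v \<noteq> w" using bw v by auto
  have yw: "y p \<noteq> w" if "p \<in> S" for p using bw y[OF that] by auto
  define N where "N x j = (1 + b * y j) * fgl_plus b x (y j)" for x j
  have ratio: "fgl_plus b x (y j) / fgl_minus b x (y j) = N x j / (x - y j)" for x j
    by (simp add: N_def fgl_minus_def)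
  define g where "g = (\<Prod>j\<in>S. [:(1 + b * y j) * y j, (1 + b * y j) * (1 + b * y j):])"
  have pg: "poly g x = (\<Prod>j\<in>S. N x j)" for x
    unfolding g_def poly_prod by (intro prod.cong refl) (simp add: N_def fgl_plus_def algebra_simps)
  have notin: "v \<notin> y ` S" "w \<notin> y ` S" using vy yw by auto
  define A where "A = insert v (insert w (y ` S))"
  have fin: "finite A" using S by (simp add: A_def)
  have card: "card A = card S + 2" using notin vw S inj by (simp add: A_def card_image)
  have "degree g \<le> (\<Sum>j\<in>S. degree [:(1 + b * y j) * y j, (1 + b * y j) * (1 + b * y j):])"
    unfolding g_def by (rule order.trans[OF degree_prod_sum_le[OF S]]) (simp add: o_def)
  also have "\<dots> \<le> (\<Sum>j\<in>S. 1)" by (intro sum_mono) simp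
  finally have deg: "degree g + 2 \<le> card A" using card by simp
  define R where "R a = poly g a / (\<Prod>c\<in>A-{a}. a - c)" for a
  have pS: "(\<Prod>c\<in>y ` S. f c) = (\<Prod>k\<in>S. f (y k))" for f :: "'a \<Rightarrow> 'a"
    using inj by (simp add: prod.reindex)
  have 0: "R v + R w + (\<Sum>p\<in>S. R (y p)) = 0"
  proof -
    have "(\<Sum>a\<in>A. R a) = R v + R w + (\<Sum>p\<in>S. R (y p))"
      using notin vw S inj by (simp add: A_def sum.reindex add.assoc)
    then show ?thesis using sum_residues_eq_0[OF fin deg] by (simp add: R_def)
  qed
  have binv: "inverse (x - w) = b * inverse (1 + b * x)" for x
    unfolding xw[symmetric] using b by simp
  have Rv: "R v = b * (inverse (1 + b * v) * (\<Prod>j\<in>S. N v j / (v - y j)))"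
  proof -
    have "A - {v} = insert w (y ` S)" using notin vw by (auto simp: A_def)
    then have "R v = inverse (v - w) * ((\<Prod>j\<in>S. N v j) / (\<Prod>j\<in>S. v - y j))"
      using notin S unfolding R_def pg by (simp add: pS field_simps)
    then show ?thesis unfolding binv prod_dividef by simp
  qed
  have Rw: "R w = - (b * inverse (1 + b * v))"
  proof -
    have e: "A - {w} = insert v (y ` S)" using notin vw by (auto simp: A_def)
    \<comment> \<open>w absorbs under the formal group law: its formal sum with any y is w again.
      Hence every factor of the product over \<open>S\<close> equals 1 at w.\<close>
    have wy: "w * (1 + b * y j) = w - y j" for j
    proof -
      have "w * (1 + b * y j) = w + (b * w) * y j" by (simp add: algebra_simps)
      then show ?thesis unfolding bw by simp
    qed
    have "N w j = w - y j" for j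
    proof -
      have "N w j = w * (1 + b * y j) * (1 + b * y j) + y j * (1 + b * y j)"
        by (simp add: N_def fgl_plus_def algebra_simps)
      also have "w * (1 + b * y j) = w - y j" by (rule wy)
      also have "(w - y j) * (1 + b * y j) + y j * (1 + b * y j) = w * (1 + b * y j) + 0"
        by (simp add: algebra_simps)
      also have "w * (1 + b * y j) = w - y j" by (rule wy)
      finally show ?thesis by simp
    qed
    moreover have "(\<Prod>j\<in>S. w - y j) \<noteq> 0" using yw S by auto
    ultimately have "R w = inverse (w - v)"
      using notin S unfolding R_def pg e by (simp add: pS inverse_eq_divide)
    also have "\<dots> = - inverse (v - w)" by (metis inverse_minus_eq minus_diff_eq)
    finally show ?thesis by (simp add: binv)
  qed
  have Ry: "R (y p) = - (b * (fgl_plus b (y p) (y p) * (\<Prod>j\<in>S-{p}. N (y p) j / (y p - y j)) * inverse (v - y p)))"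
    if p: "p \<in> S" for p
  proof -
    have e: "A - {y p} = insert v (insert w (y ` (S - {p})))"
      using notin inj p by (auto simp: A_def inj_on_def)
    have n: "v \<notin> y ` (S - {p})" "w \<notin> y ` (S - {p})" using notin by auto
    have pr: "(\<Prod>c\<in>y ` (S - {p}). f c) = (\<Prod>k\<in>S-{p}. f (y k))" for f :: "'a \<Rightarrow> 'a"
      using inj by (subst prod.reindex) (auto intro: inj_on_subset)
    have q: "(\<Prod>k\<in>S. N (y p) k) = N (y p) p * (\<Prod>k\<in>S-{p}. N (y p) k)"
      using S p by (simp add: prod.remove)
    have "R (y p) = N (y p) p * (\<Prod>k\<in>S-{p}. N (y p) k) / ((y p - v) * ((y p - w) * (\<Prod>k\<in>S-{p}. y p - y k)))"
      using n vw S unfolding R_def pg e q by (simp add: pr)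
    also have "\<dots> = N (y p) p * inverse (y p - w) * inverse (y p - v) * (\<Prod>j\<in>S-{p}. N (y p) j / (y p - y j))"
      unfolding prod_dividef by (simp add: divide_inverse mult_ac)
    also have "N (y p) p * inverse (y p - w) = b * fgl_plus b (y p) (y p)"
      unfolding binv N_def using y[OF p] by simp
    also have "inverse (y p - v) = - inverse (v - y p)" by (metis inverse_minus_eq minus_diff_eq)
    finally show ?thesis by (simp add: mult_ac)
  qed
  have "(\<Sum>p\<in>S. R (y p)) = (\<Sum>p\<in>S. - (b * (fgl_plus b (y p) (y p) *
        (\<Prod>j\<in>S-{p}. N (y p) j / (y p - y j)) * inverse (v - y p))))"
    by (rule sum.cong[OF refl Ry])
  then have "(\<Sum>p\<in>S. R (y p)) = - (b * (\<Sum>p\<in>S. fgl_plus b (y p) (y p) *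
        (\<Prod>j\<in>S-{p}. N (y p) j / (y p - y j)) * inverse (v - y p)))"
    by (simp only: sum_negf sum_distrib_left)
  then have "b * (inverse (1 + b * v) * (\<Prod>j\<in>S. N v j / (v - y j)))
    = b * (inverse (1 + b * v) + (\<Sum>p\<in>S. fgl_plus b (y p) (y p) *
        (\<Prod>j\<in>S-{p}. N (y p) j / (y p - y j)) * inverse (v - y p)))"
    using 0 unfolding Rv Rw by (simp add: distrib_left diff_eq_eq add.commute)
  then show ?thesis using b by (simp add: ratio)
qed

text \<open>The auxiliary variable \<open>u\<close> of a generating function is the variable of the inner Laurent series;
  \<open>lift_fls\<close> embeds the series not involving \<open>u\<close>, and the regular series are those without
  negative powers of \<open>u\<close>.\<close>

definition lift_fls :: "'a::comm_ring_1 fps \<Rightarrow> 'a fls fps" where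
  "lift_fls f = Abs_fps (\<lambda>d. fls_const (fps_nth f d))"

lemma fls_const_sum: "fls_const (sum f A) = (\<Sum>x\<in>A. fls_const (f x))"
  by (induction A rule: infinite_finite_induct) (simp_all flip: fls_plus_const)

interpretation lift: ring_morphism "lift_fls :: 'a::comm_ring_1 fps \<Rightarrow> 'a fls fps"
proof
  fix f g :: "'a fps"
  show "lift_fls (f + g) = lift_fls f + lift_fls g"
    by (rule fps_ext) (simp add: lift_fls_def fls_plus_const)
  show "lift_fls (f * g) = lift_fls f * lift_fls g"
    by (rule fps_ext) (simp add: lift_fls_def fps_mult_nth fls_const_sum)
  show "lift_fls (1 :: 'a fps) = 1"
    by (rule fps_ext) (simp add: lift_fls_def)
qed

lemma lift_fls_const: "lift_fls (fps_const c) = fps_const (fls_const c)"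
  by (rule fps_ext) (simp add: lift_fls_def)

lemma lift_fls_X: "lift_fls fps_X = fps_X"
  by (rule fps_ext) (simp add: lift_fls_def)

lemma lift_fls_eq_0_iff: "lift_fls f = 0 \<longleftrightarrow> f = 0"
  by (auto simp: fps_eq_iff lift_fls_def)

lemma lift_fls_divide:
  fixes f g :: "'a::field fps"
  assumes "g \<noteq> 0" "subdegree g \<le> subdegree f"
  shows "lift_fls (f / g) = lift_fls f / lift_fls g"
proof -
  have "g dvd f" using assms by (cases "f = 0") (simp_all add: fps_dvd_iff)
  then have "lift_fls f = lift_fls (f / g) * lift_fls g" by (simp flip: lift.hom_mult)
  then show ?thesis using assms(1) by (simp add: lift_fls_eq_0_iff)
qed

definition laurent_coeff :: "nat \<Rightarrow> 'a::comm_ring_1 fls fps \<Rightarrow> 'a fps" where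
  "laurent_coeff a F = Abs_fps (\<lambda>d. fls_nth (fps_nth F d) (- int a))"

lemma laurent_coeff_add: "laurent_coeff a (F + G) = laurent_coeff a F + laurent_coeff a G"
  by (rule fps_ext) (simp add: laurent_coeff_def)

lemma laurent_coeff_sum: "laurent_coeff a (sum F A) = (\<Sum>x\<in>A. laurent_coeff a (F x))"
proof -
  have "laurent_coeff a 0 = 0" by (rule fps_ext) (simp add: laurent_coeff_def)
  then show ?thesis
    by (induction A rule: infinite_finite_induct) (simp_all add: laurent_coeff_add)
qed

lemma fls_nth_sum: "fls_nth (sum f A) k = (\<Sum>x\<in>A. fls_nth (f x) k)"
  by (induction A rule: infinite_finite_induct) simp_all

lemma laurent_coeff_lift_mult: "laurent_coeff a (lift_fls c * F) = c * laurent_coeff a F"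
  by (rule fps_ext) (simp add: laurent_coeff_def lift_fls_def fps_mult_nth fls_nth_sum)

definition regular :: "'a::comm_ring_1 fls fps \<Rightarrow> bool" where
  "regular F \<longleftrightarrow> (\<forall>d. fps_nth F d \<in> range fps_to_fls)"

lemma laurent_coeff_regular: "regular F \<Longrightarrow> 0 < a \<Longrightarrow> laurent_coeff a F = 0"
proof (rule fps_ext)
  fix d assume "regular F" "0 < a"
  then obtain f where "fps_nth F d = fps_to_fls f" unfolding regular_def by blast
  then show "fps_nth (laurent_coeff a F) d = fps_nth 0 d"
    using \<open>0 < a\<close> by (simp add: laurent_coeff_def)
qed

lemma regular_add:
  assumes "regular F" "regular G"
  shows "regular (F + G)"
  unfolding regular_def
proof
  fix d
  obtain f g where "fps_nth F d = fps_to_fls f" "fps_nth G d = fps_to_fls g"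
    using assms unfolding regular_def by blast
  then show "fps_nth (F + G) d \<in> range fps_to_fls"
    by (intro range_eqI[of _ _ "f + g"]) simp
qed

lemma regular_diff:
  assumes "regular F" "regular G"
  shows "regular (F - G)"
  unfolding regular_def
proof
  fix d
  obtain f g where "fps_nth F d = fps_to_fls f" "fps_nth G d = fps_to_fls g"
    using assms unfolding regular_def by blast
  then show "fps_nth (F - G) d \<in> range fps_to_fls"
    by (intro range_eqI[of _ _ "f - g"]) simp
qed

lemma regular_mult:
  assumes "regular F" "regular G"
  shows "regular (F * G)"
proof -
  obtain f g where "\<And>d. fps_nth F d = fps_to_fls (f d)" "\<And>d. fps_nth G d = fps_to_fls (g d)"
    using assms unfolding regular_def image_iff by metis
  then have "fps_nth (F * G) d = fps_to_fls (\<Sum>i=0..d. f i * g (d - i))" for d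
    by (simp add: fps_mult_nth to_fls.hom_sum to_fls.hom_mult)
  then show ?thesis by (simp add: regular_def)
qed

lemma regular_lift: "regular (lift_fls f)"
  by (simp add: regular_def lift_fls_def flip: fps_const_to_fls)

lemma regular_const: "regular (fps_const (fps_to_fls c))"
  by (auto simp: regular_def intro: range_eqI[of _ _ 0])

lemma lift_fls_fgl_minus:
  fixes f y :: "'a::field fps"
  assumes "fps_nth y 0 = 0"
  shows "lift_fls (fgl_minus (fps_const b) f y) = fgl_minus (fps_const (fls_const b)) (lift_fls f) (lift_fls y)"
proof -
  have "subdegree (1 + fps_const b * y) = 0" "1 + fps_const b * y \<noteq> 0"
    using assms by (auto intro!: subdegree_eq_0 dest: arg_cong[of _ _ "\<lambda>f. fps_nth f 0"])
  then show ?thesis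
    unfolding fgl_minus_def
    by (simp add: lift_fls_divide lift.hom_diff lift.hom_add lift.hom_1 lift.hom_mult lift_fls_const)
qed

lemma lift_fls_fgl_plus:
  "lift_fls (fgl_plus (fps_const b) f y) = fgl_plus (fps_const (fls_const b)) (lift_fls f) (lift_fls y)"
  by (simp add: lift.hom_fgl_plus lift_fls_const)

lemma fgl_minus_nth_0:
  fixes f y :: "'a::field fps"
  assumes "fps_nth y 0 = 0"
  shows "fps_nth (fgl_minus (fps_const b) f y) 0 = fps_nth f 0"
proof -
  have "fgl_minus (fps_const b) f y = (f - y) * inverse (1 + fps_const b * y)"
    unfolding fgl_minus_def by (rule fps_divide_unit) (simp add: assms)
  then show ?thesis by (simp add: assms)
qed

lemma fgl_plus_nth_0:
  fixes f y :: "'a::comm_ring_1 fps"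
  assumes "fps_nth y 0 = 0"
  shows "fps_nth (fgl_plus (fps_const b) f y) 0 = fps_nth f 0"
  by (simp add: fgl_plus_def assms)

lemma one_plus_const_X_neq_0: "1 + fls_const b * fls_X \<noteq> (0 :: 'a::field fls)"
proof
  assume "1 + fls_const b * fls_X = 0"
  then have "fls_nth (1 + fls_const b * fls_X) 0 = 0" by simp
  then show False by simp
qed

lemma inverse_one_plus_const_X_regular: "regular (fps_const (inverse (1 + fls_const b * fls_X :: 'a::field fls)))"
proof -
  have "subdegree (1 + fps_const b * fps_X :: 'a fps) = 0" by (rule subdegree_eq_0) simp
  then have "inverse (fps_to_fls (1 + fps_const b * fps_X)) = fps_to_fls (inverse (1 + fps_const b * fps_X :: 'a fps))"
    by (rule fls_inverse_fps_to_fls)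
  also have "fps_to_fls (1 + fps_const b * fps_X) = 1 + fls_const b * fls_X"
    by (simp only: to_fls.hom_add to_fls.hom_1 to_fls.hom_mult fps_const_to_fls fps_X_to_fls)
  finally show ?thesis using regular_const by simp
qed

context fgl_variables
begin

abbreviation u :: "'k fls fps" where "u \<equiv> fps_const fls_X"

abbreviation B :: "'k fls fps" where "B \<equiv> fps_const (fls_const b)"

abbreviation xx :: "nat \<Rightarrow> 'k fls fps" where "xx p \<equiv> lift_fls (x p)"

text \<open>This is \<open>GF\<close> over an arbitrary ground field and set of variables; a smaller
  set arises when the factor of one variable is cancelled.\<close>

definition gen :: "nat set \<Rightarrow> 'k fls fps" where
  "gen S = fps_const (inverse (1 + fls_const b * fls_X)) *
     (\<Prod>j\<in>S. fgl_plus B u (xx j) / fgl_minus B u (xx j))"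

lemma xx_nth_0: "fps_nth (xx p) 0 = 0"
  by (simp add: lift_fls_def x_nth_0)

lemma xx_eq: "xx p = fps_const (fls_const (X p)) * fps_X"
  by (simp add: x_def lift.hom_mult lift_fls_const lift_fls_X)

lemma lift_variables: "fgl_variables (fls_const b) (\<lambda>p. fls_const (X p))"
proof
  show "p = q" if "fls_const (X p) = fls_const (X q)" for p q
    using arg_cong[OF that, of "\<lambda>f. fls_nth f 0"] X_inj by simp
qed (simp_all add: b_neq_0 X_neq_0)

lemma lift_x: "fgl_variables.x (\<lambda>p. fls_const (X p)) p = xx p"
  by (simp add: fgl_variables.x_def[OF lift_variables] xx_eq)

lemma lift_residue: "fgl_variables.residue (fls_const b) (\<lambda>p. fls_const (X p)) S q = lift_fls (residue S q)"
proof -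
  have "lift_fls (plus q j / minus q j) = fgl_plus B (xx q) (xx j) / fgl_minus B (xx q) (xx j)"
    if "j \<noteq> q" for j
    using that
    by (simp add: lift_fls_divide minus_neq_0 minus_dvd_plus_subdegree lift_fls_fgl_plus lift_fls_fgl_minus x_nth_0)
  then show ?thesis
    by (simp add: fgl_variables.residue_def[OF lift_variables] residue_def lift_x lift.hom_mult
        lift.hom_prod lift_fls_fgl_plus)
qed

text \<open>Partial fractions need a field, so \<open>u\<close> is turned into a scalar
  \<open>v\<close> of iterated Laurent series; the result descends because \<open>fps_to_fls\<close>
  is injective.\<close>

lemma gen_partial_fractions:
  assumes S: "finite S"
  shows "gen S = fps_const (inverse (1 + fls_const b * fls_X))
    + (\<Sum>p\<in>S. lift_fls (residue S p) * inverse (u - xx p))"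
proof -
  interpret M: fgl_variables "fls_const b" "\<lambda>p. fls_const (X p)" by (rule lift_variables)
  define v :: "'k fls fls" where "v = fls_const fls_X"
  define b' :: "'k fls fls" where "b' = fls_const (fls_const b)"
  have c: "fls_const (inverse (1 + fls_const b * fls_X)) = inverse (1 + b' * v)"
  proof -
    have "1 + b' * v = fls_const (1 + fls_const b * fls_X)"
      by (simp add: b'_def v_def flip: fls_plus_const)
    then show ?thesis by (simp only: fls_inverse_const)
  qed
  have ratio: "fps_to_fls (fgl_plus B u (xx j) / fgl_minus B u (xx j)) = fgl_plus b' v (M.xl j) / fgl_minus b' v (M.xl j)" for j
  proof -
    have "subdegree (fgl_minus B u (xx j)) = 0" by (rule subdegree_eq_0) (simp add: fgl_minus_nth_0 xx_nth_0)
    then have "fps_to_fls (fgl_plus B u (xx j) / fgl_minus B u (xx j))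
        = fps_to_fls (fgl_plus B u (xx j)) / fps_to_fls (fgl_minus B u (xx j))"
      by (intro fls_divide_fps_to_fls[symmetric]) simp
    then show ?thesis
      by (simp add: fgl_minus_to_fls xx_nth_0 to_fls.hom_fgl_plus lift_x b'_def v_def)
  qed
  have inv: "fps_to_fls (inverse (u - xx p)) = inverse (v - M.xl p)" for p
  proof -
    have "subdegree (u - xx p) = 0" by (rule subdegree_eq_0) (simp add: xx_nth_0)
    then have "inverse (fps_to_fls (u - xx p)) = fps_to_fls (inverse (u - xx p))"
      by (rule fls_inverse_fps_to_fls)
    then show ?thesis by (simp add: lift_x v_def)
  qed
  have "fps_to_fls (gen S) = inverse (1 + b' * v) * (\<Prod>j\<in>S. fgl_plus b' v (M.xl j) / fgl_minus b' v (M.xl j))"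
    by (simp only: gen_def to_fls.hom_mult to_fls.hom_prod ratio fps_const_to_fls c)
  also have "\<dots> = inverse (1 + b' * v) + (\<Sum>p\<in>S. fgl_plus b' (M.xl p) (M.xl p) *
        (\<Prod>j\<in>S-{p}. fgl_plus b' (M.xl p) (M.xl j) / fgl_minus b' (M.xl p) (M.xl j)) * inverse (v - M.xl p))"
  proof (rule partial_fractions_fgl[OF S])
    show "inj_on M.xl S"
    proof (rule inj_onI)
      fix p q assume "M.xl p = M.xl q"
      then have "fps_nth (M.x p) 1 = fps_nth (M.x q) 1" by simp
      then show "p = q" using M.X_inj by (simp add: M.x_nth_1)
    qed
    show "b' \<noteq> 0" by (simp add: b'_def b_neq_0)
    show "1 + b' * v \<noteq> 0"
      using one_plus_const_X_neq_0[of b] c by (metis fls_const_eq_0_iff inverse_nonzero_iff_nonzero)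
    show "1 + b' * M.xl p \<noteq> 0" for p unfolding b'_def by (rule M.one_plus_neq_0)
    show "v \<noteq> M.xl p" for p
    proof
      assume "v = M.xl p"
      then have "fps_to_fls u = fps_to_fls (M.x p)" by (simp add: v_def)
      then have "u = M.x p" by (simp only: fps_to_fls_eq_iff)
      then have "fps_nth u 0 = fps_nth (M.x p) 0" by (rule arg_cong)
      then show False by (simp add: M.x_nth_0)
    qed
  qed
  also have "\<dots> = fps_to_fls (fps_const (inverse (1 + fls_const b * fls_X))
    + (\<Sum>p\<in>S. lift_fls (residue S p) * inverse (u - xx p)))"
    by (simp only: to_fls.hom_add to_fls.hom_sum to_fls.hom_mult inv fps_const_to_fls c
        lift_residue[symmetric] M.residue_to_fls b'_def[symmetric])
  finally show ?thesis by (simp only: fps_to_fls_eq_iff)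
qed

text \<open>The geometric series in powers of x_p, as the expansion convention prescribes.\<close>

lemma inverse_u_minus_xx:
  "inverse (u - xx p) = Abs_fps (\<lambda>d. fls_const (X p ^ d) * fls_X_inv ^ Suc d)" (is "_ = ?A")
proof (rule fps_inverse_unique)
  show "(u - xx p) * ?A = 1"
  proof (rule fps_ext)
    fix d
    have X_inv: "fls_X * fls_X_inv = (1 :: 'k fls)" by (simp add: fls_X_times_conv_shift)
    then have c: "fls_X * (y * (fls_X_inv * z)) = y * z" for y z :: "'k fls"
      by (metis mult.assoc mult.commute mult_1)
    have e: "(u - xx p) * ?A = fps_const fls_X * ?A - fps_const (fls_const (X p)) * (fps_X * ?A)"
      by (simp add: xx_eq left_diff_distrib mult.assoc)
    show "fps_nth ((u - xx p) * ?A) d = fps_nth 1 d"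
    proof (cases d)
      case 0
      then show ?thesis unfolding e by (simp add: X_inv)
    next
      case (Suc n)
      have "fls_const (X p) * (fls_const (X p ^ n) * z) = fls_const (X p ^ Suc n) * z" for z
        by (simp add: mult.assoc[symmetric])
      then show ?thesis unfolding e Suc
        by (simp add: c mult.assoc del: power_Suc) (simp add: c)
    qed
  qed
qed

lemma laurent_coeff_inverse_u_minus_xx:
  assumes "0 < a"
  shows "laurent_coeff a (inverse (u - xx p)) = x p ^ (a - 1)"
proof -
  have "x p ^ (a - 1) = fps_const (X p ^ (a - 1)) * fps_X ^ (a - 1)"
    by (simp add: x_def power_mult_distrib)
  then show ?thesis unfolding inverse_u_minus_xx
    by (intro fps_ext) (use assms in \<open>auto simp: laurent_coeff_def simp del: power_Suc\<close>)
qed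

lemma laurent_coeff_gen:
  assumes "finite S" "0 < a"
  shows "laurent_coeff a (gen S) = (\<Sum>p\<in>S. residue S p * x p ^ (a - 1))"
  using assms
  by (simp add: gen_partial_fractions laurent_coeff_add laurent_coeff_sum laurent_coeff_lift_mult
      laurent_coeff_inverse_u_minus_xx laurent_coeff_regular inverse_one_plus_const_X_regular)

text \<open>The kernel evaluated at \<open>u1 = x p\<close> is exactly the inverse of the factor of
  x_p in the other generating function.\<close>

lemma gen_remove:
  assumes "finite S" "p \<in> S"
  shows "gen S * (fgl_minus B u (xx p) / fgl_plus B u (xx p)) = gen (S - {p})"
proof -
  let ?P = "fgl_plus B u (xx p)" and ?M = "fgl_minus B u (xx p)"
  have n: "fps_nth ?P 0 \<noteq> 0" "fps_nth ?M 0 \<noteq> 0"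
    by (simp_all add: fgl_plus_nth_0 fgl_minus_nth_0 xx_nth_0)
  have "?P / ?M * (?M / ?P) = (?P * inverse ?P) * (?M * inverse ?M)"
    unfolding fps_divide_unit[OF n(1)] fps_divide_unit[OF n(2)] by (simp only: mult_ac)
  also have "\<dots> = 1" using n by (simp add: inverse_mult_eq_1')
  finally have "?P / ?M * (?M / ?P) = 1" .
  moreover have "gen S = gen (S - {p}) * (?P / ?M)"
    using assms by (simp add: gen_def prod.remove[of S p] mult_ac)
  ultimately show ?thesis by (simp only: mult.assoc mult_1_right)
qed

end

section \<open>The two-row functions\<close>

interpretation M: fgl_variables "fls_const beta" "\<lambda>p. fls_const (Xvar p)"
  by (rule V.lift_variables)

lemma GF_u1: "GF n u1 = M.gen {..<n}"
  by (simp add: GF_def M.gen_def u1_def cF2_def xF2_def M.xx_eq)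

text \<open>\<open>u2\<close> is the inner variable, so its generating function is constant in
  \<open>u1\<close> and can be pulled out of the first coefficient extraction.\<close>

lemma lift_gen: "GF n u2 = lift_fls (V.gen {..<n})"
proof -
  have i: "inverse (1 + cF2 beta * u2) = fls_const (inverse (1 + fls_const beta * fls_X))"
  proof -
    have "1 + cF2 beta * u2 = fls_const (1 + fls_const beta * fls_X)"
      by (simp add: cF2_def u2_def flip: fls_plus_const)
    then show ?thesis by (simp only: fls_inverse_const)
  qed
  have x: "xF2 j = lift_fls (V.xx j)" for j
    by (simp add: xF2_def V.xx_eq lift.hom_mult lift_fls_const lift_fls_X cF2_def)
  have "lift_fls (fgl_plus V.B V.u (V.xx j) / fgl_minus V.B V.u (V.xx j))
    = fgl_plus (fps_const (cF2 beta)) (fps_const u2) (xF2 j) / fgl_minus (fps_const (cF2 beta)) (fps_const u2) (xF2 j)" for j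
  proof -
    have n: "fps_nth (fgl_minus V.B V.u (V.xx j)) 0 \<noteq> 0"
      by (simp add: fgl_minus_nth_0 V.xx_nth_0)
    then have "subdegree (fgl_minus V.B V.u (V.xx j)) = 0" "fgl_minus V.B V.u (V.xx j) \<noteq> 0"
      by (auto intro: subdegree_eq_0)
    then show ?thesis
      by (simp add: lift_fls_divide lift_fls_fgl_plus lift_fls_fgl_minus V.xx_nth_0 lift_fls_const cF2_def u2_def x)
  qed
  then show ?thesis
    by (simp add: GF_def V.gen_def lift.hom_mult lift.hom_prod lift_fls_const i)
qed

lemma GQ2_laurent_coeff:
  "GQ2 n a b = laurent_coeff b (laurent_coeff a (M.gen {..<n} * lift_fls (V.gen {..<n}) * fps_const Hfac))"
  by (simp add: GQ2_def laurent_coeff_def GF_u1 lift_gen)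

text \<open>Removing the pole of \<open>h(s) / (s - t)\<close> at \<open>s = t\<close>, for \<open>h(s) = (v - s) / ((1 + c s) (v + s + c v s))\<close>.\<close>

lemma kernel_identity:
  fixes v s t c I1 I2 I3 I4 J :: "'a::comm_ring_1"
  assumes "(1 + c * s) * I1 = 1" "fgl_plus c v s * I2 = 1" "(1 + c * t) * I3 = 1" "fgl_plus c v t * I4 = 1" "(s - t) * J = 1"
  shows "J * ((v - s) * I1 * I2) = (v - t) * I3 * I4 * J
    + (c * (1 + c * v) * s * t - v * (2 + 2 * c * v) - v * (c * (1 + c * v)) * (s + t)) * (I1 * I2) * (I3 * I4)"
proof -
  define D where "D = (1 + c * s) * fgl_plus c v s"
  define E where "E = (1 + c * t) * fgl_plus c v t"
  define P where "P = c * (1 + c * v) * s * t - v * (2 + 2 * c * v) - v * (c * (1 + c * v)) * (s + t)"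
  have D: "D * (I1 * I2) = 1" using assms(1,2) unfolding D_def by (metis mult.assoc mult.commute mult_1_right)
  have E: "E * (I3 * I4) = 1" using assms(3,4) unfolding E_def by (metis mult.assoc mult.commute mult_1_right)
  \<comment> \<open>The left side is a polynomial vanishing at s = t; \<open>P\<close> is its
    quotient by s - t.\<close>
  have N: "(v - s) * E - (v - t) * D = (s - t) * P"
    by (simp add: D_def E_def P_def fgl_plus_def algebra_simps)
  have "J * ((v - s) * I1 * I2) = J * ((v - s) * (I1 * I2)) * (E * (I3 * I4))" by (simp add: E mult.assoc)
  also have "\<dots> = ((v - s) * E - (v - t) * D) * J * (I1 * I2) * (I3 * I4) + (v - t) * (D * (I1 * I2)) * (I3 * I4) * J"
    by (simp add: algebra_simps)
  also have "\<dots> = P * ((s - t) * J) * (I1 * I2) * (I3 * I4) + (v - t) * I3 * I4 * J"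
    unfolding N D by (simp add: mult_ac)
  finally show ?thesis unfolding assms(5) P_def by simp
qed

text \<open>At \<open>u1 = 0\<close> the formal sum is \<open>u2\<close>, a unit among Laurent
  series in \<open>u2\<close>. This is where the convention of expanding in powers of
  \<open>u1\<close> enters.\<close>

lemma u2_plus_u1_regular: "regular (fps_const (inverse (fgl_plus (cF2 beta) u2 u1)))"
proof -
  define f :: "coef fls fps" where "f = fgl_plus (fps_const (fls_const beta)) (fps_const fls_X) fps_X"
  have "subdegree f = 0" by (rule subdegree_eq_0) (simp add: f_def fgl_plus_nth_0)
  then have "inverse (fps_to_fls f) = fps_to_fls (inverse f)" by (rule fls_inverse_fps_to_fls)
  moreover have "fps_to_fls f = fgl_plus (cF2 beta) u2 u1"
    by (simp add: f_def to_fls.hom_fgl_plus cF2_def u1_def u2_def)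
  ultimately show ?thesis using regular_const by metis
qed

text \<open>In front of a simple pole the kernel may be replaced by its value at the pole; the
  remainder \<open>Q\<close> is regular in \<open>u1\<close> and invisible to coefficients of
  negative powers.\<close>

lemma pole_at_variable:
  "\<exists>Q. regular Q \<and> inverse (M.u - M.xx p) * fps_const Hfac
    = lift_fls (fgl_minus V.B V.u (V.xx p) / fgl_plus V.B V.u (V.xx p)) * inverse (M.u - M.xx p) + Q"
proof -
  define c :: "F2 fps" where "c = fps_const (cF2 beta)"
  define s :: "F2 fps" where "s = fps_const u1"
  define v :: "F2 fps" where "v = fps_const u2"
  define t where "t = lift_fls (V.xx p)"
  define I1 where "I1 = fps_const (inverse (1 + cF2 beta * u1))"
  define I2 where "I2 = fps_const (inverse (fgl_plus (cF2 beta) u2 u1))"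
  define I3 where "I3 = lift_fls (inverse (1 + V.B * V.xx p))"
  define I4 where "I4 = lift_fls (inverse (fgl_plus V.B V.u (V.xx p)))"
  define J where "J = inverse (s - t)"
  have t: "t = M.xx p" unfolding t_def by (simp add: V.lift_x)
  have n1: "1 + cF2 beta * u1 \<noteq> 0"
    unfolding cF2_def u1_def by (rule one_plus_const_X_neq_0)
  have n2: "fgl_plus (cF2 beta) u2 u1 \<noteq> 0"
  proof
    assume "fgl_plus (cF2 beta) u2 u1 = 0"
    then have "fls_nth (fgl_plus (cF2 beta) u2 u1) 0 = 0" by simp
    then show False by (simp add: fgl_plus_def cF2_def u1_def u2_def)
  qed
  have c': "lift_fls V.B = c" by (simp add: lift_fls_const c_def cF2_def)
  have v': "lift_fls V.u = v" by (simp add: lift_fls_const v_def u2_def)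
  have n3: "fps_nth (1 + V.B * V.xx p) 0 \<noteq> 0" by (simp add: V.xx_nth_0)
  have n4: "fps_nth (fgl_plus V.B V.u (V.xx p)) 0 \<noteq> 0" by (simp add: fgl_plus_nth_0 V.xx_nth_0)
  have 1: "(1 + c * s) * I1 = 1"
  proof -
    have "1 + c * s = fps_const (1 + cF2 beta * u1)" by (rule fps_ext) (simp add: c_def s_def)
    then show ?thesis using n1 by (simp add: I1_def)
  qed
  have 2: "fgl_plus c v s * I2 = 1"
    using n2 by (simp add: c_def s_def v_def I2_def fgl_plus_def)
  have 3: "(1 + c * t) * I3 = 1"
    unfolding I3_def t_def c'[symmetric] using inverse_mult_eq_1'[OF n3]
    by (simp flip: lift.hom_mult lift.hom_1 lift.hom_add)
  have 4: "fgl_plus c v t * I4 = 1"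
    unfolding I4_def t_def c'[symmetric] v'[symmetric] using inverse_mult_eq_1'[OF n4]
    by (simp flip: lift.hom_fgl_plus lift.hom_mult) (simp add: lift.hom_1)
  have 5: "(s - t) * J = 1"
    unfolding J_def by (rule inverse_mult_eq_1') (simp add: t M.xx_nth_0 s_def u1_def)
  have H: "fps_const Hfac = (v - s) * I1 * I2"
    by (simp add: Hfac_def fgl_minus_def v_def s_def I1_def I2_def divide_inverse)
  have L: "lift_fls (fgl_minus V.B V.u (V.xx p) / fgl_plus V.B V.u (V.xx p)) = (v - t) * I3 * I4"
    unfolding fps_divide_unit[OF n4] fgl_minus_def fps_divide_unit[OF n3]
    by (simp add: lift.hom_mult lift.hom_diff v' I3_def I4_def t_def)
  have reg: "regular c" "regular s" "regular v" "regular t" "regular I1" "regular I2" "regular I3" "regular I4"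
  proof -
    show "regular c" "regular v" unfolding c'[symmetric] v'[symmetric] by (rule regular_lift)+
    show "regular s" using regular_const[of fps_X] by (simp add: s_def u1_def)
    show "regular t" "regular I3" "regular I4" unfolding t_def I3_def I4_def by (rule regular_lift)+
    show "regular I1" unfolding I1_def cF2_def u1_def by (rule inverse_one_plus_const_X_regular)
    show "regular I2" unfolding I2_def by (rule u2_plus_u1_regular)
  qed
  have "regular (1 :: F2 fps)" using regular_const[of 1] by simp
  moreover from regular_add[OF this this] have "regular (2 :: F2 fps)" by simp
  moreover note reg
  ultimately have reg: "regular c" "regular s" "regular v" "regular t" "regular I1" "regular I2" "regular I3" "regular I4"
    "regular (1 :: F2 fps)" "regular (2 :: F2 fps)" by blast+
  define Q where "Q = (c * (1 + c * v) * s * t - v * (2 + 2 * c * v) - v * (c * (1 + c * v)) * (s + t)) * (I1 * I2) * (I3 * I4)"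
  have "regular Q" unfolding Q_def by (intro regular_mult regular_add regular_diff reg)
  moreover have "J * fps_const Hfac = lift_fls (fgl_minus V.B V.u (V.xx p) / fgl_plus V.B V.u (V.xx p)) * J + Q"
    unfolding H L Q_def by (rule kernel_identity[OF 1 2 3 4 5])
  ultimately show ?thesis unfolding J_def t s_def u1_def by blast
qed

text \<open>Only the poles at \<open>u1 = x p\<close> contribute to negative powers of
  \<open>u1\<close>. The value of the kernel there cancels the factor of x_p in the generating
  function of \<open>u2\<close>, so the second extraction sees only the variables with q different
  from p.\<close>

lemma GQ2_sum_residues:
  assumes a: "0 < a" and b: "0 < b"
  shows "GQ2 n a b = (\<Sum>p<n. \<Sum>q\<in>{..<n}-{p}.
    V.residue {..<n} p * V.x p ^ (a - 1) * (V.residue ({..<n} - {p}) q * V.x q ^ (b - 1)))"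
proof -
  let ?S = "{..<n}"
  let ?G = "V.gen ?S"
  let ?h = "\<lambda>p. fgl_minus V.B V.u (V.xx p) / fgl_plus V.B V.u (V.xx p)"
  obtain Q where Q: "\<And>p. regular (Q p)"
    and J: "\<And>p. inverse (M.u - M.xx p) * fps_const Hfac = lift_fls (?h p) * inverse (M.u - M.xx p) + Q p"
    using pole_at_variable by metis
  define E where "E = fps_const (inverse (1 + fls_const (fls_const beta) * fls_X :: F2))"
  have H: "regular (fps_const Hfac)"
  proof -
    have "fps_const Hfac = (fps_const u2 - fps_const u1) * fps_const (inverse (1 + cF2 beta * u1))
        * fps_const (inverse (fgl_plus (cF2 beta) u2 u1))"
      by (simp add: Hfac_def fgl_minus_def divide_inverse)
    moreover have "regular (fps_const u2)" using regular_lift[of V.u] by (simp add: lift_fls_const u2_def)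
    moreover have "regular (fps_const u1)" using regular_const[of fps_X] by (simp add: u1_def)
    ultimately show ?thesis
      using inverse_one_plus_const_X_regular[of "fls_const beta"] u2_plus_u1_regular
      by (simp only: cF2_def u1_def) (intro regular_mult regular_diff)
  qed
  have "M.gen ?S * lift_fls ?G * fps_const Hfac
    = E * lift_fls ?G * fps_const Hfac
      + (\<Sum>p\<in>?S. lift_fls (M.residue ?S p * ?G) * (inverse (M.u - M.xx p) * fps_const Hfac))"
  proof -
    have "M.gen ?S = E + (\<Sum>p\<in>?S. lift_fls (M.residue ?S p) * inverse (M.u - M.xx p))"
      unfolding E_def by (rule M.gen_partial_fractions) simp
    then show ?thesis
      by (simp only: distrib_right sum_distrib_right lift.hom_mult) (simp only: mult_ac)
  qed
  also have "\<dots> = (E * lift_fls ?G * fps_const Hfac + (\<Sum>p\<in>?S. lift_fls (M.residue ?S p * ?G) * Q p))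
      + (\<Sum>p\<in>?S. lift_fls (M.residue ?S p * (?G * ?h p)) * inverse (M.u - M.xx p))"
    unfolding J by (simp add: distrib_left sum.distrib lift.hom_mult mult_ac)
  finally have e: "M.gen ?S * lift_fls ?G * fps_const Hfac
    = (E * lift_fls ?G * fps_const Hfac + (\<Sum>p\<in>?S. lift_fls (M.residue ?S p * ?G) * Q p))
      + (\<Sum>p\<in>?S. lift_fls (M.residue ?S p * (?G * ?h p)) * inverse (M.u - M.xx p))" .
  have "regular (E * lift_fls ?G * fps_const Hfac)"
    unfolding E_def by (intro regular_mult inverse_one_plus_const_X_regular regular_lift H)
  moreover have "laurent_coeff a (Q p) = 0" for p
    using Q a by (simp add: laurent_coeff_regular)
  ultimately have "laurent_coeff a (M.gen ?S * lift_fls ?G * fps_const Hfac)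
    = (\<Sum>p\<in>?S. M.residue ?S p * (?G * ?h p) * M.x p ^ (a - 1))"
    unfolding e using a
    by (simp add: laurent_coeff_add laurent_coeff_sum laurent_coeff_regular laurent_coeff_lift_mult
        M.laurent_coeff_inverse_u_minus_xx)
  also have "\<dots> = (\<Sum>p\<in>?S. lift_fls (V.residue ?S p * V.x p ^ (a - 1)) * V.gen (?S - {p}))"
    by (intro sum.cong refl) (simp add: V.gen_remove V.lift_residue V.lift_x lift.hom_mult lift.hom_power mult_ac)
  finally show ?thesis
    unfolding GQ2_laurent_coeff using b
    by (simp add: laurent_coeff_sum laurent_coeff_lift_mult V.laurent_coeff_gen sum_distrib_left)
qed

section \<open>Binomial series\<close>

text \<open>Restores the factor of x_p that the extraction in \<open>u1\<close> cancelled; it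
  reappears as the ratio in the Pfaffian entry.\<close>

lemma residue_remove_to_fls:
  assumes "p < n" "p \<noteq> q"
  shows "fps_to_fls (V.residue ({..<n} - {p}) q)
    = fps_to_fls (V.residue {..<n} q) * fgl_ratio (fls_const beta) (V.xl p) (V.xl q)"
proof -
  define R where "R j = fgl_plus (fls_const beta) (V.xl q) (V.xl j) / fgl_minus (fls_const beta) (V.xl q) (V.xl j)" for j
  have "R p \<noteq> 0"
    unfolding R_def V.plus_to_fls[symmetric] V.minus_to_fls[symmetric]
    using assms V.plus_neq_0 V.minus_neq_0[of q p] by simp
  moreover have "{..<n} - {q} = insert p ({..<n} - {p} - {q})" using assms by auto
  then have "(\<Prod>j\<in>{..<n} - {q}. R j) = R p * (\<Prod>j\<in>{..<n} - {p} - {q}. R j)"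
    using assms by simp
  moreover have "fgl_ratio (fls_const beta) (V.xl p) (V.xl q) = inverse (R p)"
    by (simp add: fgl_ratio_def R_def)
  ultimately show ?thesis
    unfolding V.residue_to_fls R_def[symmetric] by simp
qed

text \<open>The weights \<open>f\<close> and \<open>g\<close> stay arbitrary so that binomial series
  can be inserted. The terms with q = p may be added because the ratio vanishes on the
  diagonal.\<close>

lemma sum_residues_to_fls:
  "fps_to_fls (\<Sum>p<n. \<Sum>q\<in>{..<n}-{p}. V.residue {..<n} p * f p * (V.residue ({..<n} - {p}) q * g q))
    = (\<Sum>p<n. \<Sum>q<n. fps_to_fls (V.residue {..<n} p * f p) * fps_to_fls (V.residue {..<n} q * g q)
        * fgl_ratio (fls_const beta) (V.xl p) (V.xl q))"
proof -
  have "fps_to_fls (\<Sum>p<n. \<Sum>q\<in>{..<n}-{p}. V.residue {..<n} p * f p * (V.residue ({..<n} - {p}) q * g q))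
    = (\<Sum>p<n. \<Sum>q\<in>{..<n}-{p}. fps_to_fls (V.residue {..<n} p * f p) * fps_to_fls (V.residue {..<n} q * g q)
        * fgl_ratio (fls_const beta) (V.xl p) (V.xl q))"
    unfolding to_fls.hom_sum to_fls.hom_mult
    by (intro sum.cong refl) (auto simp: residue_remove_to_fls)
  also have "\<dots> = (\<Sum>p<n. \<Sum>q<n. fps_to_fls (V.residue {..<n} p * f p) * fps_to_fls (V.residue {..<n} q * g q)
        * fgl_ratio (fls_const beta) (V.xl p) (V.xl q))"
  proof (rule sum.cong[OF refl], rule sum.mono_neutral_left, goal_cases)
    case (3 p)
    show ?case
    proof
      fix q assume "q \<in> {..<n} - ({..<n} - {p})"
      then have "q = p" by auto
      then show "fps_to_fls (V.residue {..<n} p * f p) * fps_to_fls (V.residue {..<n} q * g q)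
          * fgl_ratio (fls_const beta) (V.xl p) (V.xl q) = 0"
        by (simp add: fgl_ratio_def fgl_minus_def)
    qed
  qed auto
  finally show ?thesis .
qed

definition binomial_series :: "int \<Rightarrow> 'a::comm_ring_1 \<Rightarrow> 'a fps" where
  "binomial_series N y = Abs_fps (\<lambda>k. of_int (binom_int N k) * y ^ k)"

text \<open>Integer \<open>gchoose\<close> is the same product divided by \<open>fact k\<close>, so
  its Pascal rule transfers, exactness of the division included.\<close>

lemma binom_int_Suc_Suc: "binom_int (N + 1) (Suc k) = binom_int N k + binom_int N (Suc k)"
  using gbinomial_int_Suc_Suc[of N k]
  by (simp only: gbinomial_prod_rev binom_int_def atLeast0LessThan)

lemma binom_int_0: "binom_int N 0 = 1" "binom_int 0 (Suc k) = 0"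
  by (simp_all add: binom_int_def prod.lessThan_Suc_shift del: prod.lessThan_Suc)

lemma binomial_series_Suc: "binomial_series (N + 1) y = (1 + fps_const y * fps_X) * binomial_series N y"
proof (rule fps_ext)
  fix d
  show "fps_nth (binomial_series (N + 1) y) d = fps_nth ((1 + fps_const y * fps_X) * binomial_series N y) d"
  proof (cases d)
    case 0
    then show ?thesis by (simp add: binomial_series_def binom_int_0)
  next
    case (Suc k)
    then show ?thesis
      by (simp add: binomial_series_def binom_int_Suc_Suc distrib_right mult.assoc)
  qed
qed

lemma binomial_series_0: "binomial_series 0 y = 1"
proof (rule fps_ext)
  show "fps_nth (binomial_series 0 y) d = fps_nth 1 d" for d
    by (cases d) (simp_all add: binomial_series_def binom_int_0)
qed

lemma binomial_series_uminus: "(1 + fps_const y * fps_X) ^ M * binomial_series (- int M) y = 1"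
proof (induction M)
  case 0
  show ?case by (simp add: binomial_series_0)
next
  case (Suc M)
  have "binomial_series (- int M) y = (1 + fps_const y * fps_X) * binomial_series (- int (Suc M)) y"
    using binomial_series_Suc[of "- int (Suc M)" y] by simp
  with Suc show ?case by (simp add: mult_ac)
qed

text \<open>As x_p is \<open>Xvar p\<close> times t, the parameter \<open>beta * Xvar p\<close>
  makes this a series in x_p. For N <= 0 it is identified as the inverse of a nonnegative
  power.\<close>

lemma binomial_series_to_fls:
  assumes "N \<le> 0"
  shows "fps_to_fls (binomial_series N (beta * Xvar p)) = (1 + fls_const beta * V.xl p) powi N"
proof -
  obtain M where N: "N = - int M" using assms by (metis nonpos_int_cases)
  have "fps_to_fls (1 + fps_const (beta * Xvar p) * fps_X) = 1 + fls_const beta * V.xl p"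
    unfolding V.one_plus_to_fls[symmetric] by (simp add: V.x_def mult.assoc flip: fps_const_mult)
  then have "(1 + fls_const beta * V.xl p) ^ M * fps_to_fls (binomial_series N (beta * Xvar p)) = 1"
    using arg_cong[OF binomial_series_uminus[of "beta * Xvar p" M], of fps_to_fls]
    by (simp only: N to_fls.hom_mult to_fls.hom_power to_fls.hom_1)
  then show ?thesis
    by (simp add: N power_int_minus inverse_unique)
qed

text \<open>Each coefficient of the partial sums is eventually constant. This implies convergence of
  power series, hence evaluates \<open>suminf\<close>, and its closure under multiples and finite
  sums is elementary.\<close>

definition coeff_sums :: "(nat \<Rightarrow> 'a::comm_ring_1 fps) \<Rightarrow> 'a fps \<Rightarrow> bool" where
  "coeff_sums f s \<longleftrightarrow> (\<forall>d. \<forall>\<^sub>F n in sequentially. fps_nth (\<Sum>k<n. f k) d = fps_nth s d)"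

lemma coeff_sums_suminf:
  assumes "coeff_sums f s"
  shows "suminf f = s"
proof -
  have "f sums s" unfolding sums_def
    by (rule tendsto_fpsI) (use assms in \<open>simp add: coeff_sums_def\<close>)
  then show ?thesis by (simp add: sums_iff)
qed

lemma coeff_sums_mult_left:
  assumes "coeff_sums f s"
  shows "coeff_sums (\<lambda>k. c * f k) (c * s)"
  unfolding coeff_sums_def
proof
  fix d
  have "\<forall>\<^sub>F n in sequentially. \<forall>i\<in>{0..d}. fps_nth (\<Sum>k<n. f k) i = fps_nth s i"
    using assms by (intro eventually_ball_finite) (auto simp: coeff_sums_def)
  then show "\<forall>\<^sub>F n in sequentially. fps_nth (\<Sum>k<n. c * f k) d = fps_nth (c * s) d"
    by (rule eventually_mono) (simp add: fps_mult_nth flip: sum_distrib_left)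
qed

lemma coeff_sums_sum:
  assumes "\<And>p. p \<in> A \<Longrightarrow> coeff_sums (f p) (s p)"
  shows "coeff_sums (\<lambda>k. \<Sum>p\<in>A. f p k) (\<Sum>p\<in>A. s p)"
proof (cases "finite A")
  case True
  show ?thesis unfolding coeff_sums_def
  proof
    fix d
    have "\<forall>\<^sub>F n in sequentially. \<forall>p\<in>A. fps_nth (\<Sum>k<n. f p k) d = fps_nth (s p) d"
      using assms True by (intro eventually_ball_finite) (auto simp: coeff_sums_def)
    then show "\<forall>\<^sub>F n in sequentially. fps_nth (\<Sum>k<n. \<Sum>p\<in>A. f p k) d = fps_nth (\<Sum>p\<in>A. s p) d"
      by (rule eventually_mono) (subst sum.swap, simp add: fps_sum_nth)
  qed
qed (simp add: coeff_sums_def)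

lemma coeff_sums_powers: "coeff_sums (\<lambda>k. fps_const (c k) * fps_X ^ k) (Abs_fps c)"
  unfolding coeff_sums_def
proof
  fix d
  show "\<forall>\<^sub>F n in sequentially. fps_nth (\<Sum>k<n. fps_const (c k) * fps_X ^ k) d = fps_nth (Abs_fps c) d"
    by (rule eventually_mono[OF eventually_gt_at_top[of d]]) (simp add: fps_sum_nth if_distrib cong: if_cong)
qed

lemma coeff_sums_binomial:
  "coeff_sums (\<lambda>k. fps_const (beta ^ k * of_int (binom_int N k)) * V.x p ^ k) (binomial_series N (beta * Xvar p))"
proof -
  have "fps_const (beta ^ k * of_int (binom_int N k)) * V.x p ^ k
    = fps_const (of_int (binom_int N k) * (beta * Xvar p) ^ k) * fps_X ^ k" for k
    by (simp add: V.x_def power_mult_distrib mult_ac flip: fps_const_mult fps_const_power)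
  then show ?thesis unfolding binomial_series_def by (simp only: coeff_sums_powers)
qed

text \<open>By \<open>GQ2_sum_residues\<close>, raising the indices by k and l only multiplies the
  (p, q) term by x_p^k x_q^l, so the double series splits into two binomial series, summed over l
  first and then over k.\<close>

lemma suminf_GQ2_to_fls:
  assumes a: "0 < a" and b: "0 < b" and N: "N \<le> 0" and M: "M \<le> 0"
  shows "fps_to_fls (suminf (\<lambda>k. suminf (\<lambda>l. fps_const (beta ^ (k + l)
               * of_int (binom_int N k) * of_int (binom_int M l)) * GQ2 n (a + k) (b + l))))
    = (\<Sum>p<n. \<Sum>q<n.
      (fps_to_fls (V.residue {..<n} p) * V.xl p ^ (a - 1)) * (fps_to_fls (V.residue {..<n} q) * V.xl q ^ (b - 1)) *
      ((1 + fls_const beta * V.xl p) powi N * (1 + fls_const beta * V.xl q) powi M *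
       fgl_ratio (fls_const beta) (V.xl p) (V.xl q)))"
proof -
  define S where "S = {..<n}"
  define C where "C p q = V.residue S p * V.x p ^ (a - 1) * (V.residue (S - {p}) q * V.x q ^ (b - 1))" for p q
  define T where "T L k p = fps_const (beta ^ k * of_int (binom_int L k)) * V.x p ^ k" for L k p
  define E where "E L p = binomial_series L (beta * Xvar p)" for L p
  have T: "coeff_sums (\<lambda>k. T L k p) (E L p)" for L p
    unfolding T_def E_def by (rule coeff_sums_binomial)
  have summand: "fps_const (beta ^ (k + l) * of_int (binom_int N k) * of_int (binom_int M l)) * GQ2 n (a + k) (b + l)
    = (\<Sum>p\<in>S. \<Sum>q\<in>S-{p}. C p q * T N k p * T M l q)" for k l
  proof -
    \<comment> \<open>The subtraction is truncated; positivity of a and b makes this regrouping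
      valid.\<close>
    have e: "a + k - 1 = a - 1 + k" "b + l - 1 = b - 1 + l" using a b by auto
    have c: "fps_const (beta ^ (k + l) * of_int (binom_int N k) * of_int (binom_int M l))
      = fps_const (beta ^ k * of_int (binom_int N k)) * fps_const (beta ^ l * of_int (binom_int M l))"
      by (simp add: power_add mult_ac)
    have "0 < a + k" "0 < b + l" using a b by auto
    then show ?thesis
      unfolding c unfolding GQ2_sum_residues[OF \<open>0 < a + k\<close> \<open>0 < b + l\<close>] e power_add sum_distrib_left S_def[symmetric]
      by (intro sum.cong refl) (simp only: C_def T_def mult_ac)
  qed
  have "suminf (\<lambda>l. \<Sum>p\<in>S. \<Sum>q\<in>S-{p}. C p q * T N k p * T M l q)
    = (\<Sum>p\<in>S. \<Sum>q\<in>S-{p}. C p q * T N k p * E M q)" for k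
    by (intro coeff_sums_suminf coeff_sums_sum coeff_sums_mult_left T)
  moreover have "suminf (\<lambda>k. \<Sum>p\<in>S. \<Sum>q\<in>S-{p}. C p q * E M q * T N k p)
    = (\<Sum>p\<in>S. \<Sum>q\<in>S-{p}. C p q * E M q * E N p)"
    by (intro coeff_sums_suminf coeff_sums_sum coeff_sums_mult_left T)
  moreover have "C p q * T N k p * E M q = C p q * E M q * T N k p" for p q k by (simp only: mult_ac)
  ultimately have "suminf (\<lambda>k. suminf (\<lambda>l. fps_const (beta ^ (k + l)
               * of_int (binom_int N k) * of_int (binom_int M l)) * GQ2 n (a + k) (b + l)))
    = (\<Sum>p\<in>S. \<Sum>q\<in>S-{p}. C p q * E M q * E N p)"
    by (simp only: summand)
  also have "\<dots> = (\<Sum>p<n. \<Sum>q\<in>{..<n}-{p}. V.residue {..<n} p * (V.x p ^ (a - 1) * E N p)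
      * (V.residue ({..<n} - {p}) q * (V.x q ^ (b - 1) * E M q)))"
    unfolding S_def C_def by (simp only: mult_ac)
  finally have *: "suminf (\<lambda>k. suminf (\<lambda>l. fps_const (beta ^ (k + l)
               * of_int (binom_int N k) * of_int (binom_int M l)) * GQ2 n (a + k) (b + l))) = \<dots>" .
  show ?thesis
    unfolding * sum_residues_to_fls to_fls.hom_mult to_fls.hom_power E_def
      binomial_series_to_fls[OF N] binomial_series_to_fls[OF M]
    by (intro sum.cong refl) (simp only: mult_ac)
qed

theorem mainTheorem8:
  fixes n m :: nat and nu :: "nat list"
  assumes "length nu = 2 * m" and "2 * m \<le> n"
    and "sorted_wrt (>) nu" and "\<forall>p\<in>set nu. p > 0"
  shows "GQ n nu = pfaffian m (\<lambda>i j.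
           suminf (\<lambda>k. suminf (\<lambda>l. fps_const (beta ^ (k + l)
               * of_int (binom_int (int i + 1 - 2 * int m) k)
               * of_int (binom_int (int j - 2 * int m) l))
             * GQ2 n (nu ! (i - 1) + k) (nu ! (j - 1) + l))))"
proof -
  have pos: "0 < nu ! (i - 1)" if "i \<in> {1..2*m}" for i
  proof -
    have "i - 1 < length nu" using that assms(1) by auto
    then show ?thesis using assms(4) nth_mem by blast
  qed
  have "fps_to_fls (GQ n nu) = fps_to_fls (pfaffian m (\<lambda>i j.
           suminf (\<lambda>k. suminf (\<lambda>l. fps_const (beta ^ (k + l)
               * of_int (binom_int (int i + 1 - 2 * int m) k)
               * of_int (binom_int (int j - 2 * int m) l))
             * GQ2 n (nu ! (i - 1) + k) (nu ! (j - 1) + l)))))"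
    unfolding GQ_pfaffian_to_fls[OF assms(1,2)] to_fls.hom_pfaffian
  proof (rule pfaffian_cong, rule suminf_GQ2_to_fls[symmetric])
    fix i j assume ij: "i \<in> {1..2*m}" "j \<in> {1..2*m}" "i < j"
    show "0 < nu ! (i - 1)" "0 < nu ! (j - 1)" using ij pos by blast+
    \<comment> \<open>From i < j and j <= 2m also i + 1 <= 2m.\<close>
    show "int i + 1 - 2 * int m \<le> 0" "int j - 2 * int m \<le> 0" using ij by auto
  qed
  then show ?thesis by (simp only: fps_to_fls_eq_iff)
qed

end
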